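(* Let $k\ge 1$ be an integer and let $\boldsymbol{X}=(X_1,\ldots,X_k)^{t}$ be a random vector which follows either the multinomial distribution $\mathrm{m}_k(n,\boldsymbol{\pi})$ (with $n\ge 1$ an integer, $\boldsymbol{\pi}=(\pi_1,\ldots,\pi_k)^t\in(0,1)^k$, $\pi_0:=1-\sum_{i=1}^k\pi_i>0$) or the negative multinomial distribution $\mathrm{nm}_k(r,\boldsymbol{\theta})$ (with $r>0$ real, $\boldsymbol{\theta}=(\theta_1,\ldots,\theta_k)^t\in(0,1)^k$, $\theta_0:=1-\sum_{i=1}^k\theta_i>0$). Let $\Sigma$ be the variance-covariance matrix of $\boldsymbol{X}$, and set $$w(\boldsymbol{x})=\frac{n-\sum_{i=1}^k x_i}{n\pi_0}\ \text{ in the multinomial case,}\qquad w(\boldsymbol{x})=\frac{\theta_0\left(r+\sum_{i=1}^k x_i\right)}{r}\ \text{ in the negative multinomial case.}$$ Let $g:\mathbb{R}^k\to\mathbb{R}$ be a function such that $\operatorname{Var} g(\boldsymbol{X})<\infty$. Then $$\operatorname{Var} g(\boldsymbol{X})\le \mathbb{E}\left[w(\boldsymbol{X})\,\nabla^{t} g(\boldsymbol{X})\,\Sigma\,\nabla g(\boldsymbol{X})\right],$$ where $\nabla g$ is the discrete (forward difference) gradient of $g$ and the right-hand side is allowed to be $+\infty$. Moreover, equality holds if and only if $g$ is a linear function of $x_1,\ldots,x_k$ on the support of $\boldsymbol{X}$, i.e. there are real constants $\rho_0,\rho_1,\ldots,\rho_k$ such that $g(\boldsymbol{x})=\rho_0+\sum_{i=1}^k\rho_i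 x_i$ for all $\boldsymbol{x}$ in the support of $\boldsymbol{X}$.
   Context: Here $\mathbb{N}=\{0,1,2,\ldots\}$. Discrete gradient: for $g:\mathbb{R}^k\to\mathbb{R}$, $g_i(\boldsymbol{x})=g(\boldsymbol{x}+\boldsymbol{e}_i)-g(\boldsymbol{x})$, where $\boldsymbol{e}_i$ is the $i$-th standard basis vector of $\mathbb{R}^k$, and $\nabla g(\boldsymbol{x})=(g_1(\boldsymbol{x}),\ldots,g_k(\boldsymbol{x}))^t$, $\nabla^t g=(\nabla g)^t$. Multinomial $\mathrm{m}_k(n,\boldsymbol{\pi})$: the distribution with probability mass function $p(\boldsymbol{x})=\frac{n!}{x_1!\cdots x_k!\,x_0!}\,\pi_1^{x_1}\cdots\pi_k^{x_k}\pi_0^{x_0}$ for $\boldsymbol{x}\in\mathbb{N}^k$ with $\sum_{i=1}^k x_i\le n$, where $x_0=n-\sum_{i=1}^k x_i$; this set of $\boldsymbol{x}$ is its support. Negative multinomial $\mathrm{nm}_k(r,\boldsymbol{\theta})$: the distribution with probability mass function $p(\boldsymbol{x})=\frac{\Gamma\left(r+\sum_{i=1}^k x_i\right)}{x_1!\cdots x_k!\,\Gamma(r)}\,\theta_1^{x_1}\cdots\theta_k^{x_k}\theta_0^{r}$ for $\boldsymbol{x}\in\mathbb{N}^k$; its support is $\mathbb{N}^k$. *)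

theory Defs
  imports "HOL-Probability.Probability"
begin

text \<open>
  Random vectors take values in \<open>nat ^ 'k\<close>; the finite index type \<open>'k\<close> (nonempty, as every type)
  plays the role of \<open>{1, ..., k}\<close>. The index 0 of the probability vectors lies outside \<open>'k\<close>, so
  the remaining cell \<open>x\<^sub>0\<close> and its probability are written out separately.
\<close>

definition real_vec :: "nat ^ 'k \<Rightarrow> real ^ 'k" where
  "real_vec x = (\<chi> i. real (x $ i))"

definition rest_prob :: "real ^ 'k \<Rightarrow> real" where
  "rest_prob \<pi> = 1 - (\<Sum>i\<in>UNIV. \<pi> $ i)"

definition valid_probs :: "real ^ 'k \<Rightarrow> bool" where
  "valid_probs \<pi> \<longleftrightarrow> (\<forall>i. 0 < \<pi> $ i \<and> \<pi> $ i < 1) \<and> 0 < rest_prob \<pi>"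

definition multinomial_support :: "nat \<Rightarrow> (nat ^ 'k) set" where
  "multinomial_support n = {x. (\<Sum>i\<in>UNIV. x $ i) \<le> n}"

definition multinomial_pmf :: "nat \<Rightarrow> real ^ 'k \<Rightarrow> nat ^ 'k \<Rightarrow> real" where
  "multinomial_pmf n \<pi> x =
     (if x \<in> multinomial_support n then
        let x0 = n - (\<Sum>i\<in>UNIV. x $ i) in
          fact n / ((\<Prod>i\<in>UNIV. fact (x $ i)) * fact x0) *
          (\<Prod>i\<in>UNIV. \<pi> $ i ^ (x $ i)) * rest_prob \<pi> ^ x0
      else 0)"

definition multinomial_weight :: "nat \<Rightarrow> real ^ 'k \<Rightarrow> real ^ 'k \<Rightarrow> real" where
  "multinomial_weight n \<pi> x = (real n - (\<Sum>i\<in>UNIV. x $ i)) / (real n * rest_prob \<pi>)"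

definition neg_multinomial_support :: "(nat ^ 'k) set" where
  "neg_multinomial_support = UNIV"

definition neg_multinomial_pmf :: "real \<Rightarrow> real ^ 'k \<Rightarrow> nat ^ 'k \<Rightarrow> real" where
  "neg_multinomial_pmf r \<theta> x =
     Gamma (r + real (\<Sum>i\<in>UNIV. x $ i)) / ((\<Prod>i\<in>UNIV. fact (x $ i)) * Gamma r) *
     (\<Prod>i\<in>UNIV. \<theta> $ i ^ (x $ i)) * rest_prob \<theta> powr r"

definition neg_multinomial_weight :: "real \<Rightarrow> real ^ 'k \<Rightarrow> real ^ 'k \<Rightarrow> real" where
  "neg_multinomial_weight r \<theta> x = rest_prob \<theta> * (r + (\<Sum>i\<in>UNIV. x $ i)) / r"

definition has_pmf :: "'a measure \<Rightarrow> ('a \<Rightarrow> nat ^ 'k) \<Rightarrow> (nat ^ 'k \<Rightarrow> real) \<Rightarrow> bool" where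
  "has_pmf M X p \<longleftrightarrow> distributed M (count_space UNIV) X (\<lambda>x. ennreal (p x))"

definition variance_of :: "'a measure \<Rightarrow> ('a \<Rightarrow> real) \<Rightarrow> real" where
  "variance_of M Y = prob_space.variance M Y"

text \<open>
  The Bochner integral is 0 for a non-integrable function, so finiteness of the variance has to be
  stated separately.
\<close>

definition finite_variance :: "'a measure \<Rightarrow> ('a \<Rightarrow> real) \<Rightarrow> bool" where
  "finite_variance M Y \<longleftrightarrow>
     integrable M Y \<and> integrable M (\<lambda>\<omega>. (Y \<omega> - integral\<^sup>L M Y)\<^sup>2)"

definition covariance_matrix :: "'a measure \<Rightarrow> ('a \<Rightarrow> real ^ 'k) \<Rightarrow> real ^ 'k ^ 'k" where
  "covariance_matrix M Z =
     (\<chi> i j. \<integral>\<omega>. (Z \<omega> $ i - (\<integral>\<omega>'. Z \<omega>' $ i \<partial>M)) * (Z \<omega> $ j - (\<integral>\<omega>'. Z \<omega>' $ j \<partial>M)) \<partial>M)"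

definition discrete_gradient :: "(real ^ 'k \<Rightarrow> real) \<Rightarrow> real ^ 'k \<Rightarrow> real ^ 'k" where
  "discrete_gradient g x = (\<chi> i. g (x + axis i 1) - g x)"

text \<open>
  The upper bound may be infinite, hence the nonnegative integral. The truncation by
  \<open>ennreal\<close> is harmless: the covariance matrix is positive semidefinite and the weights in
  question are nonnegative on the support.
\<close>

definition weighted_gradient_bound ::
  "'a measure \<Rightarrow> ('a \<Rightarrow> real ^ 'k) \<Rightarrow> (real ^ 'k \<Rightarrow> real) \<Rightarrow> (real ^ 'k \<Rightarrow> real) \<Rightarrow> ennreal" where
  "weighted_gradient_bound M Z w g =
     (\<integral>\<^sup>+\<omega>. ennreal (w (Z \<omega>) *
        (discrete_gradient g (Z \<omega>) \<bullet> (covariance_matrix M Z *v discrete_gradient g (Z \<omega>)))) \<partial>M)"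

definition linear_on_support :: "(real ^ 'k \<Rightarrow> real) \<Rightarrow> (nat ^ 'k) set \<Rightarrow> bool" where
  "linear_on_support g S \<longleftrightarrow>
     (\<exists>(\<rho>0 :: real) (\<rho> :: real ^ 'k). \<forall>x\<in>S.
        g (real_vec x) = \<rho>0 + (\<Sum>i\<in>UNIV. \<rho> $ i * real (x $ i)))"

end

theory Submission
  imports Defs
begin

text \<open>
  The quadratic form \<open>v \<bullet> \<Sigma> v\<close> is the variance of the linear function with slopes \<open>v\<close>, and the
  weight turns the law of \<open>X\<close> into the one with parameter \<open>n - 1\<close> (resp. \<open>r + 1\<close>).

  In the multinomial case \<open>X\<close> is a sum of \<open>n\<close> independent unit steps, and the bound becomes
  \<open>n E Var\<^sub>J g(Y + e\<^sub>J)\<close> with \<open>Y\<close> multinomial with \<open>n - 1\<close> trials and \<open>J\<close> one further trial: this is the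
  Efron--Stein inequality, proved by induction on \<open>n\<close>. The loss in each induction step is an average
  of squared mixed second differences of \<open>g\<close>.

  In the negative multinomial case the total \<open>N\<close> of \<open>X\<close> is negative binomial, and given \<open>N\<close> the
  vector is multinomial with \<open>N\<close> trials and no remaining cell. Efron--Stein bounds the conditional
  variance, and a one-dimensional Poincare inequality bounds the variance of the conditional mean;
  the latter follows by writing the variance as a sum over pairs \<open>m < n\<close> and applying Cauchy--Schwarz
  to the telescoping sum of \<open>h n - h m\<close>. Equality in all of these steps makes every second
  difference of \<open>g\<close> vanish.
\<close>

section \<open>Weighted variances\<close>

definition weighted_var :: "('j::finite \<Rightarrow> real) \<Rightarrow> ('j \<Rightarrow> real) \<Rightarrow> real" where
  "weighted_var q f = (\<Sum>j\<in>UNIV. q j * (f j)\<^sup>2) - (\<Sum>j\<in>UNIV. q j * f j)\<^sup>2"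

text \<open>Expanding the square gives the second moment twice and the squared mean as cross term,
  since \<open>q\<close> sums to 1. Working with differences makes shift invariance and the zero
  case visible.\<close>

lemma weighted_var_pairs:
  assumes "sum q UNIV = 1"
  shows "weighted_var q f = (\<Sum>j\<in>UNIV. \<Sum>l\<in>UNIV. q j * q l * (f j - f l)\<^sup>2) / 2"
proof -
  have "(\<Sum>j\<in>UNIV. \<Sum>l\<in>UNIV. q j * q l * (f j - f l)\<^sup>2) =
      (\<Sum>j\<in>UNIV. \<Sum>l\<in>UNIV. (q j * (f j)\<^sup>2) * q l) + (\<Sum>j\<in>UNIV. \<Sum>l\<in>UNIV. q j * (q l * (f l)\<^sup>2))
      - 2 * (\<Sum>j\<in>UNIV. \<Sum>l\<in>UNIV. (q j * f j) * (q l * f l))"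
    by (simp add: sum.distrib[symmetric] sum_subtractf[symmetric] sum_distrib_left
        power2_eq_square algebra_simps)
  also have "\<dots> = 2 * weighted_var q f"
    unfolding weighted_var_def sum_product[symmetric] assms by (simp add: power2_eq_square)
  finally show ?thesis by simp
qed

lemma weighted_var_shift:
  assumes "sum q UNIV = 1"
  shows "weighted_var q (\<lambda>j. f j + c) = weighted_var q f"
  by (simp add: weighted_var_pairs[OF assms])

lemma weighted_var_nonneg:
  assumes "sum q UNIV = 1" "\<And>j. 0 \<le> q j"
  shows "0 \<le> weighted_var q f"
  unfolding weighted_var_pairs[OF assms(1)] using assms(2) by (auto intro!: sum_nonneg)

lemma weighted_var_eq_0D:
  assumes "sum q UNIV = 1" "\<And>j. 0 \<le> q j" "weighted_var q f = 0" "0 < q j" "0 < q l"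
  shows "f j = f l"
proof -
  have *: "0 \<le> q j * q l * (f j - f l)\<^sup>2" for j l
    using assms(2) by simp
  have "(\<Sum>j\<in>UNIV. \<Sum>l\<in>UNIV. q j * q l * (f j - f l)\<^sup>2) = 0"
    using assms(3) unfolding weighted_var_pairs[OF assms(1)] by simp
  hence "(\<Sum>l\<in>UNIV. q j * q l * (f j - f l)\<^sup>2) = 0"
    by (subst (asm) sum_nonneg_eq_0_iff) (auto intro!: sum_nonneg *)
  hence "q j * q l * (f j - f l)\<^sup>2 = 0"
    by (subst (asm) sum_nonneg_eq_0_iff) (auto intro!: *)
  thus ?thesis using assms(4,5) by simp
qed

section \<open>Multinomial expectations\<close>

text \<open>The index \<open>None\<close> stands for the remaining cell 0.\<close>

definition cell_prob :: "real ^ 'k \<Rightarrow> 'k option \<Rightarrow> real" where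
  "cell_prob \<pi> j = (case j of None \<Rightarrow> rest_prob \<pi> | Some i \<Rightarrow> \<pi> $ i)"

definition cell_step :: "'k option \<Rightarrow> nat ^ 'k" where
  "cell_step j = (case j of None \<Rightarrow> 0 | Some i \<Rightarrow> axis i 1)"

definition total :: "nat ^ 'k \<Rightarrow> nat" where
  "total x = (\<Sum>i\<in>UNIV. x $ i)"

definition multinomial_expect :: "nat \<Rightarrow> real ^ 'k \<Rightarrow> (nat ^ 'k \<Rightarrow> real) \<Rightarrow> real" where
  "multinomial_expect n \<pi> f = (\<Sum>x\<in>multinomial_support n. multinomial_pmf n \<pi> x * f x)"

definition multinomial_var :: "nat \<Rightarrow> real ^ 'k \<Rightarrow> (nat ^ 'k \<Rightarrow> real) \<Rightarrow> real" where
  "multinomial_var n \<pi> f = multinomial_expect n \<pi> (\<lambda>x. (f x)\<^sup>2) - (multinomial_expect n \<pi> f)\<^sup>2"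

definition step_mean :: "real ^ 'k \<Rightarrow> (nat ^ 'k \<Rightarrow> real) \<Rightarrow> nat ^ 'k \<Rightarrow> real" where
  "step_mean \<pi> f y = (\<Sum>j\<in>UNIV. cell_prob \<pi> j * f (y + cell_step j))"

definition step_var :: "real ^ 'k \<Rightarrow> (nat ^ 'k \<Rightarrow> real) \<Rightarrow> nat ^ 'k \<Rightarrow> real" where
  "step_var \<pi> f y = weighted_var (cell_prob \<pi>) (\<lambda>j. f (y + cell_step j))"

text \<open>
  The loss in \<open>Var\<^sub>J (E\<^sub>M f(y + e\<^sub>M + e\<^sub>J)) \<le> E\<^sub>M (Var\<^sub>J f(y + e\<^sub>M + e\<^sub>J))\<close>, where \<open>J\<close>, \<open>M\<close> are independent.
\<close>

definition mixed_var :: "real ^ 'k \<Rightarrow> (nat ^ 'k \<Rightarrow> real) \<Rightarrow> nat ^ 'k \<Rightarrow> real" where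
  "mixed_var \<pi> f y = (\<Sum>j\<in>UNIV. \<Sum>l\<in>UNIV. cell_prob \<pi> j * cell_prob \<pi> l *
     weighted_var (cell_prob \<pi>)
       (\<lambda>m. f (y + cell_step m + cell_step j) - f (y + cell_step m + cell_step l))) / 2"

lemma sum_option: "(\<Sum>j\<in>UNIV. F j) = F None + (\<Sum>i\<in>UNIV. F (Some i))"
  for F :: "'k::finite option \<Rightarrow> 'b::comm_monoid_add"
  by (simp add: UNIV_option_conv sum.reindex)

lemma sum_cell_prob: "sum (cell_prob \<pi>) UNIV = 1"
  by (simp add: sum_option cell_prob_def rest_prob_def)

lemma cell_step_simps [simp]: "cell_step None = 0" "cell_step (Some i) = axis i 1"
  by (simp_all add: cell_step_def)

lemma cell_prob_simps [simp]: "cell_prob \<pi> None = rest_prob \<pi>" "cell_prob \<pi> (Some i) = \<pi> $ i"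
  by (simp_all add: cell_prob_def)

lemma total_add [simp]: "total (x + y) = total x + total y"
  by (simp add: total_def sum.distrib)

lemma total_0 [simp]: "total 0 = 0"
  by (simp add: total_def)

lemma total_axis [simp]: "total (axis i c) = c"
  by (simp add: total_def axis_def)

lemma in_multinomial_support: "x \<in> multinomial_support n \<longleftrightarrow> total x \<le> n"
  by (simp add: multinomial_support_def total_def)

lemma finite_multinomial_support [simp]: "finite (multinomial_support n :: (nat ^ 'k) set)"
proof -
  have "multinomial_support n \<subseteq> (vec_lambda ` (UNIV \<rightarrow>\<^sub>E {..n}) :: (nat ^ 'k) set)"
  proof
    fix x :: "nat ^ 'k" assume "x \<in> multinomial_support n"
    hence "x $ i \<le> n" for i
      using member_le_sum[of i UNIV "\<lambda>i. x $ i"] by (simp add: in_multinomial_support total_def)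
    hence "vec_nth x \<in> UNIV \<rightarrow>\<^sub>E {..n}" by auto
    moreover have "x = vec_lambda (vec_nth x)" by simp
    ultimately show "x \<in> vec_lambda ` (UNIV \<rightarrow>\<^sub>E {..n})" by blast
  qed
  thus ?thesis by (rule finite_subset) (auto intro!: finite_imageI finite_PiE)
qed

section \<open>Absorption identities and the recursion in the number of trials\<close>

lemma multinomial_pmf_outside: "n < total x \<Longrightarrow> multinomial_pmf n \<pi> x = 0"
  by (simp add: multinomial_pmf_def in_multinomial_support)

lemma multinomial_pmf_inside:
  "total x \<le> n \<Longrightarrow> multinomial_pmf n \<pi> x =
     fact n / ((\<Prod>i\<in>UNIV. fact (x $ i)) * fact (n - total x)) *
     (\<Prod>i\<in>UNIV. \<pi> $ i ^ (x $ i)) * rest_prob \<pi> ^ (n - total x)"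
  by (simp add: multinomial_pmf_def in_multinomial_support Let_def total_def)

text \<open>Absorption for the remaining cell: the factor cancels the top of
  \<open>fact (Suc m)\<close>. This is the identity behind the multinomial weight.\<close>

lemma multinomial_pmf_rest:
  "multinomial_pmf (Suc n) \<pi> x * real (Suc n - total x) =
     real (Suc n) * rest_prob \<pi> * multinomial_pmf n \<pi> x"
proof (cases "total x \<le> n")
  case True
  then obtain m where m: "n - total x = m" "Suc n - total x = Suc m"
    by (simp add: Suc_diff_le)
  have "(fact n :: real) > 0" "(fact m :: real) > 0" by simp_all
  with True m show ?thesis
    by (simp add: multinomial_pmf_inside field_simps del: of_nat_Suc)
next
  case False
  thus ?thesis by (simp add: multinomial_pmf_outside)
qed

lemma prod_add_axis:
  fixes F :: "'k::finite \<Rightarrow> nat \<Rightarrow> real"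
  assumes "F i (Suc (x $ i)) = c * F i (x $ i)"
  shows "(\<Prod>j\<in>UNIV. F j ((x + axis i 1) $ j)) = c * (\<Prod>j\<in>UNIV. F j (x $ j))"
proof -
  have "(\<Prod>j\<in>UNIV - {i}. F j ((x + axis i 1) $ j)) = (\<Prod>j\<in>UNIV - {i}. F j (x $ j))"
    by (rule prod.cong) (auto simp: axis_def)
  moreover have "F i ((x + axis i 1) $ i) = c * F i (x $ i)"
    using assms by (simp add: axis_def)
  ultimately show ?thesis
    by (simp add: prod.remove[of UNIV i])
qed

text \<open>Absorption for a proper cell: raising one coordinate multiplies the product of powers by
  \<open>\<pi> $ i\<close> and the product of factorials by \<open>Suc (y $ i)\<close>.\<close>

lemma multinomial_pmf_add_axis:
  "multinomial_pmf (Suc n) \<pi> (y + axis i 1) * real (Suc (y $ i)) =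
     real (Suc n) * \<pi> $ i * multinomial_pmf n \<pi> y"
proof (cases "total y \<le> n")
  case True
  have 1: "(\<Prod>j\<in>UNIV. \<pi> $ j ^ ((y + axis i 1) $ j)) = \<pi> $ i * (\<Prod>j\<in>UNIV. \<pi> $ j ^ (y $ j))"
    by (rule prod_add_axis[where F="\<lambda>j m. \<pi> $ j ^ m"]) simp
  have 2: "(\<Prod>j\<in>UNIV. fact ((y + axis i 1) $ j)) = real (Suc (y $ i)) * (\<Prod>j\<in>UNIV. fact (y $ j))"
    by (rule prod_add_axis[where F="\<lambda>j m. fact m"]) simp
  have "total (y + axis i 1) \<le> Suc n" "Suc n - total (y + axis i 1) = n - total y"
    using True by simp_all
  thus ?thesis using True
    unfolding multinomial_pmf_inside[OF True] multinomial_pmf_inside[OF \<open>total (y + axis i 1) \<le> Suc n\<close>] 1 2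
    by (simp add: field_simps del: of_nat_Suc)
next
  case False
  hence "Suc n < total (y + axis i 1)" by simp
  thus ?thesis using False multinomial_pmf_outside by (metis mult_zero_left mult_zero_right not_le)
qed

lemma add_axis_diff:
  assumes "0 < x $ i"
  shows "(x - axis i 1) + axis i 1 = (x :: nat ^ 'k)"
  using assms by (auto simp: vec_eq_iff axis_def)

lemma multinomial_expect_cong:
  assumes "\<And>x. total x \<le> n \<Longrightarrow> f x = g x"
  shows "multinomial_expect n \<pi> f = multinomial_expect n \<pi> g"
  unfolding multinomial_expect_def using assms by (intro sum.cong) (auto simp: in_multinomial_support)

text \<open>Size biasing: vectors with \<open>x $ i = 0\<close> contribute nothing, the others are
  unit shifts of vectors with one trial fewer, and absorption removes the factor.\<close>

lemma multinomial_expect_component: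
  "(\<Sum>x\<in>multinomial_support (Suc n). multinomial_pmf (Suc n) \<pi> x * (real (x $ i) * f x)) =
     real (Suc n) * \<pi> $ i * multinomial_expect n \<pi> (\<lambda>y. f (y + axis i 1))"
proof -
  have img: "(\<lambda>y. y + axis i 1) ` multinomial_support n =
      {x \<in> multinomial_support (Suc n). 0 < x $ i}" (is "?L = ?R")
  proof
    have "0 < (y + axis i 1) $ i" for y :: "nat ^ 'a" by (simp add: axis_def)
    thus "?L \<subseteq> ?R" by (auto simp: in_multinomial_support)
    show "?R \<subseteq> ?L"
    proof
      fix x assume x: "x \<in> ?R"
      hence *: "x = (x - axis i 1) + axis i 1" by (intro add_axis_diff[symmetric]) simp
      hence "total x = total ((x - axis i 1) + axis i 1)" by simp
      also have "\<dots> = total (x - axis i 1) + 1" by (simp only: total_add total_axis)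
      finally have "x - axis i 1 \<in> multinomial_support n"
        using x by (simp add: in_multinomial_support)
      thus "x \<in> ?L" using * by blast
    qed
  qed
  have "(\<Sum>x\<in>multinomial_support (Suc n). multinomial_pmf (Suc n) \<pi> x * (real (x $ i) * f x)) =
      (\<Sum>x\<in>?R. multinomial_pmf (Suc n) \<pi> x * (real (x $ i) * f x))"
    by (rule sum.mono_neutral_right) auto
  also have "\<dots> = (\<Sum>y\<in>multinomial_support n. multinomial_pmf (Suc n) \<pi> (y + axis i 1) *
      (real ((y + axis i 1) $ i) * f (y + axis i 1)))"
    unfolding img[symmetric] by (subst sum.reindex) (auto simp: inj_on_def)
  also have "\<dots> = (\<Sum>y\<in>multinomial_support n.
      (multinomial_pmf (Suc n) \<pi> (y + axis i 1) * real (Suc (y $ i))) * f (y + axis i 1))"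
    by (simp add: axis_def mult.assoc)
  also have "\<dots> = real (Suc n) * \<pi> $ i * multinomial_expect n \<pi> (\<lambda>y. f (y + axis i 1))"
    unfolding multinomial_pmf_add_axis multinomial_expect_def by (simp add: sum_distrib_left mult.assoc)
  finally show ?thesis .
qed

lemma multinomial_expect_0 [simp]: "multinomial_expect 0 \<pi> f = f 0"
proof -
  have "multinomial_support 0 = {0 :: nat ^ 'a}"
    by (auto simp: multinomial_support_def vec_eq_iff)
  moreover have "multinomial_pmf 0 \<pi> 0 = 1"
    by (subst multinomial_pmf_inside) auto
  ultimately show ?thesis by (simp add: multinomial_expect_def)
qed

text \<open>Each trial falls into one cell, so \<open>Suc n\<close> is the sum of all cell counts;
  absorbing each count leaves \<open>n\<close> trials. This amounts to conditioning on one trial and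
  drives the inductions on \<open>n\<close>.\<close>

lemma multinomial_expect_Suc:
  "multinomial_expect (Suc n) \<pi> f = multinomial_expect n \<pi> (step_mean \<pi> f)"
proof -
  let ?S = "multinomial_support (Suc n)" and ?p = "multinomial_pmf (Suc n) \<pi>"
  have "real (Suc n) * multinomial_expect (Suc n) \<pi> f = (\<Sum>x\<in>?S. ?p x * (real (Suc n) * f x))"
    by (simp add: multinomial_expect_def sum_distrib_left mult_ac)
  also have "\<dots> = (\<Sum>x\<in>?S. (?p x * real (Suc n - total x)) * f x +
      (\<Sum>i\<in>UNIV. ?p x * (real (x $ i) * f x)))"
  proof (rule sum.cong)
    fix x :: "nat ^ 'a" assume "x \<in> ?S"
    hence "real (Suc n) = real (Suc n - total x) + (\<Sum>i\<in>UNIV. real (x $ i))"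
      by (simp only: of_nat_sum[symmetric] of_nat_add[symmetric] in_multinomial_support) (simp add: total_def)
    thus "?p x * (real (Suc n) * f x) = (?p x * real (Suc n - total x)) * f x +
      (\<Sum>i\<in>UNIV. ?p x * (real (x $ i) * f x))"
      by (simp only: sum_distrib_left[symmetric] sum_distrib_right[symmetric]) (simp add: algebra_simps)
  qed simp
  also have "\<dots> = (\<Sum>x\<in>?S. (?p x * real (Suc n - total x)) * f x) +
      (\<Sum>i\<in>UNIV. real (Suc n) * \<pi> $ i * multinomial_expect n \<pi> (\<lambda>y. f (y + axis i 1)))"
    unfolding sum.distrib multinomial_expect_component[symmetric]
    by (subst sum.swap[of _ ?S]) (rule refl)
  also have "(\<Sum>x\<in>?S. (?p x * real (Suc n - total x)) * f x) =
      (\<Sum>x\<in>multinomial_support n. real (Suc n) * rest_prob \<pi> * multinomial_pmf n \<pi> x * f x)"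
    unfolding multinomial_pmf_rest
    by (rule sum.mono_neutral_right) (auto simp: in_multinomial_support multinomial_pmf_outside)
  also have "\<dots> + (\<Sum>i\<in>UNIV. real (Suc n) * \<pi> $ i * multinomial_expect n \<pi> (\<lambda>y. f (y + axis i 1))) =
      real (Suc n) * multinomial_expect n \<pi> (step_mean \<pi> f)"
    unfolding multinomial_expect_def step_mean_def sum_option
    by (simp add: sum_distrib_left sum.distrib algebra_simps sum.swap[of _ "multinomial_support n"]
        del: of_nat_Suc)
  finally show ?thesis by (simp del: of_nat_Suc)
qed

section \<open>The Efron--Stein inequality for multinomial vectors\<close>

definition nonneg_probs :: "real ^ 'k \<Rightarrow> bool" where
  "nonneg_probs \<pi> \<longleftrightarrow> (\<forall>j. 0 \<le> cell_prob \<pi> j)"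

lemma nonneg_probsD: "nonneg_probs \<pi> \<Longrightarrow> 0 \<le> cell_prob \<pi> j"
  by (simp add: nonneg_probs_def)

lemma multinomial_expect_add:
  "multinomial_expect n \<pi> (\<lambda>x. f x + g x) = multinomial_expect n \<pi> f + multinomial_expect n \<pi> g"
  by (simp add: multinomial_expect_def distrib_left sum.distrib)

lemma multinomial_expect_diff:
  "multinomial_expect n \<pi> (\<lambda>x. f x - g x) = multinomial_expect n \<pi> f - multinomial_expect n \<pi> g"
  by (simp add: multinomial_expect_def right_diff_distrib sum_subtractf)

lemma multinomial_expect_cmult:
  "multinomial_expect n \<pi> (\<lambda>x. c * f x) = c * multinomial_expect n \<pi> f"
  by (simp add: multinomial_expect_def sum_distrib_left mult_ac)

lemma step_mean_const [simp]: "step_mean \<pi> (\<lambda>_. c) = (\<lambda>_. c)"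
  by (simp add: step_mean_def fun_eq_iff sum_distrib_right[symmetric] sum_cell_prob)

lemma multinomial_expect_const [simp]: "multinomial_expect n \<pi> (\<lambda>_. c) = c"
  by (induction n) (simp_all add: multinomial_expect_Suc)

lemma multinomial_pmf_nonneg:
  assumes "nonneg_probs \<pi>"
  shows "0 \<le> multinomial_pmf n \<pi> x"
  using nonneg_probsD[OF assms, of None] nonneg_probsD[OF assms, of "Some _"]
  by (cases "total x \<le> n")
     (auto simp: multinomial_pmf_inside multinomial_pmf_outside intro!: mult_nonneg_nonneg divide_nonneg_nonneg prod_nonneg)

lemma multinomial_expect_nonneg:
  assumes "nonneg_probs \<pi>" "\<And>x. 0 \<le> f x"
  shows "0 \<le> multinomial_expect n \<pi> f"
  unfolding multinomial_expect_def
  by (intro sum_nonneg mult_nonneg_nonneg multinomial_pmf_nonneg assms)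

lemma multinomial_expect_eq_0D:
  assumes "nonneg_probs \<pi>" "\<And>x. 0 \<le> f x" "multinomial_expect n \<pi> f = 0" "0 < multinomial_pmf n \<pi> x"
  shows "f x = 0"
proof -
  have x: "x \<in> multinomial_support n"
    using assms(4) multinomial_pmf_outside[of n x \<pi>] by (fastforce simp: in_multinomial_support)
  have "\<forall>x\<in>multinomial_support n. multinomial_pmf n \<pi> x * f x = 0"
    using assms(3) unfolding multinomial_expect_def
    by (subst (asm) sum_nonneg_eq_0_iff)
       (auto intro!: mult_nonneg_nonneg multinomial_pmf_nonneg assms(1,2) simp del: mult_eq_0_iff)
  with x have "multinomial_pmf n \<pi> x * f x = 0" by blast
  thus ?thesis using assms(4) by simp
qed

text \<open>The centre \<open>c\<close> is free: it is the expectation itself in the positivity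
  lemmas and the overall mean of the mixture in the negative multinomial case.\<close>

lemma multinomial_var_centred:
  "multinomial_var n \<pi> f = multinomial_expect n \<pi> (\<lambda>x. (f x - c)\<^sup>2) - (multinomial_expect n \<pi> f - c)\<^sup>2"
proof -
  have "(\<lambda>x. (f x - c)\<^sup>2) = (\<lambda>x. (f x)\<^sup>2 + ((-2 * c) * f x + c\<^sup>2))"
    by (simp add: fun_eq_iff power2_eq_square algebra_simps)
  thus ?thesis
    by (simp only: multinomial_expect_add multinomial_expect_cmult multinomial_expect_const
        multinomial_var_def) (simp add: power2_eq_square algebra_simps)
qed

lemma multinomial_var_nonneg:
  assumes "nonneg_probs \<pi>"
  shows "0 \<le> multinomial_var n \<pi> f"
  unfolding multinomial_var_centred[of n \<pi> f "multinomial_expect n \<pi> f"]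
  by (simp add: multinomial_expect_nonneg[OF assms])

lemma multinomial_var_eq_0D:
  assumes "nonneg_probs \<pi>" "multinomial_var n \<pi> f = 0" "0 < multinomial_pmf n \<pi> x"
  shows "f x = multinomial_expect n \<pi> f"
proof -
  have "(f x - multinomial_expect n \<pi> f)\<^sup>2 = 0"
    using assms(2) unfolding multinomial_var_centred[of n \<pi> f "multinomial_expect n \<pi> f"]
    by (intro multinomial_expect_eq_0D[OF assms(1) _ _ assms(3), where f="\<lambda>x. (f x - multinomial_expect n \<pi> f)\<^sup>2"]) simp_all
  thus ?thesis by simp
qed

lemma multinomial_var_cong:
  assumes "\<And>x. total x \<le> n \<Longrightarrow> f x = g x"
  shows "multinomial_var n \<pi> f = multinomial_var n \<pi> g"
  using assms by (simp add: multinomial_var_def cong: multinomial_expect_cong)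

lemma multinomial_var_add_const: "multinomial_var n \<pi> (\<lambda>x. f x + c) = multinomial_var n \<pi> f"
  unfolding multinomial_var_centred[of n \<pi> "\<lambda>x. f x + c" c] multinomial_expect_add
  by (simp add: multinomial_var_def)

lemma step_var_nonneg:
  assumes "nonneg_probs \<pi>"
  shows "0 \<le> step_var \<pi> f y"
  unfolding step_var_def
  by (rule weighted_var_nonneg[OF sum_cell_prob nonneg_probsD[OF assms]])

lemma mixed_var_nonneg:
  assumes "nonneg_probs \<pi>"
  shows "0 \<le> mixed_var \<pi> f y"
  unfolding mixed_var_def
  by (intro divide_nonneg_nonneg sum_nonneg mult_nonneg_nonneg nonneg_probsD[OF assms]
      weighted_var_nonneg sum_cell_prob) simp

text \<open>A vanishing sum of nonnegative terms makes each variance over \<open>m\<close> with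
  positive weights vanish, so its argument is constant on the cells of positive probability.\<close>

lemma mixed_var_eq_0D:
  assumes \<pi>: "nonneg_probs \<pi>" and "mixed_var \<pi> f y = 0"
    and pos: "0 < cell_prob \<pi> j" "0 < cell_prob \<pi> l" "0 < cell_prob \<pi> m" "0 < cell_prob \<pi> m'"
  shows "f (y + cell_step m + cell_step j) - f (y + cell_step m + cell_step l) =
         f (y + cell_step m' + cell_step j) - f (y + cell_step m' + cell_step l)"
proof -
  let ?W = "\<lambda>j l. weighted_var (cell_prob \<pi>)
       (\<lambda>m. f (y + cell_step m + cell_step j) - f (y + cell_step m + cell_step l))"
  have *: "0 \<le> cell_prob \<pi> j * cell_prob \<pi> l * ?W j l" for j l
    by (intro mult_nonneg_nonneg nonneg_probsD[OF \<pi>] weighted_var_nonneg sum_cell_prob)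
  have "(\<Sum>j\<in>UNIV. \<Sum>l\<in>UNIV. cell_prob \<pi> j * cell_prob \<pi> l * ?W j l) = 0"
    using assms(2) by (simp add: mixed_var_def)
  hence "(\<Sum>l\<in>UNIV. cell_prob \<pi> j * cell_prob \<pi> l * ?W j l) = 0"
    by (subst (asm) sum_nonneg_eq_0_iff) (auto intro!: sum_nonneg *)
  hence "cell_prob \<pi> j * cell_prob \<pi> l * ?W j l = 0"
    by (subst (asm) sum_nonneg_eq_0_iff) (auto intro!: *)
  hence "?W j l = 0" using pos by simp
  from weighted_var_eq_0D[OF sum_cell_prob nonneg_probsD[OF \<pi>] this pos(3,4)] show ?thesis .
qed

text \<open>Exact form of the convexity bound for the variance of an average: in the pairwise
  formula each pair loses the mean of the square minus the square of the mean over \<open>m\<close>,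
  which is a \<open>weighted_var\<close>.\<close>

lemma step_var_step_mean:
  "step_var \<pi> (step_mean \<pi> f) y = step_mean \<pi> (step_var \<pi> f) y - mixed_var \<pi> f y"
proof -
  let ?q = "cell_prob \<pi>"
  let ?d = "\<lambda>j l m. f (y + cell_step m + cell_step j) - f (y + cell_step m + cell_step l)"
  have 1: "step_var \<pi> (step_mean \<pi> f) y =
      (\<Sum>j\<in>UNIV. \<Sum>l\<in>UNIV. ?q j * ?q l * (\<Sum>m\<in>UNIV. ?q m * ?d j l m)\<^sup>2) / 2"
  proof -
    have "step_mean \<pi> f (y + cell_step j) - step_mean \<pi> f (y + cell_step l) = (\<Sum>m\<in>UNIV. ?q m * ?d j l m)" for j l
      by (simp add: step_mean_def sum_subtractf right_diff_distrib add_ac)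
    thus ?thesis
      unfolding step_var_def weighted_var_pairs[OF sum_cell_prob] by simp
  qed
  have "step_mean \<pi> (step_var \<pi> f) y =
      (\<Sum>m\<in>UNIV. \<Sum>j\<in>UNIV. \<Sum>l\<in>UNIV. ?q m * (?q j * ?q l * (?d j l m)\<^sup>2)) / 2"
    unfolding step_mean_def step_var_def weighted_var_pairs[OF sum_cell_prob]
    by (simp add: sum_distrib_left sum_divide_distrib)
  also have "(\<Sum>m\<in>UNIV. \<Sum>j\<in>UNIV. \<Sum>l\<in>UNIV. ?q m * (?q j * ?q l * (?d j l m)\<^sup>2)) =
      (\<Sum>j\<in>UNIV. \<Sum>m\<in>UNIV. \<Sum>l\<in>UNIV. ?q m * (?q j * ?q l * (?d j l m)\<^sup>2))"
    by (rule sum.swap)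
  also have "\<dots> = (\<Sum>j\<in>UNIV. \<Sum>l\<in>UNIV. \<Sum>m\<in>UNIV. ?q m * (?q j * ?q l * (?d j l m)\<^sup>2))"
    by (intro sum.cong refl sum.swap)
  also have "\<dots> = (\<Sum>j\<in>UNIV. \<Sum>l\<in>UNIV. ?q j * ?q l * (\<Sum>m\<in>UNIV. ?q m * (?d j l m)\<^sup>2))"
    by (simp add: sum_distrib_left mult_ac)
  finally have 2: "step_mean \<pi> (step_var \<pi> f) y =
      (\<Sum>j\<in>UNIV. \<Sum>l\<in>UNIV. ?q j * ?q l * (\<Sum>m\<in>UNIV. ?q m * (?d j l m)\<^sup>2)) / 2" .
  show ?thesis
    unfolding 1 2 mixed_var_def weighted_var_def
    by (simp add: right_diff_distrib sum_subtractf diff_divide_distrib)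
qed

text \<open>Law of total variance, conditioning on the first \<open>n\<close> trials.\<close>

lemma multinomial_var_Suc:
  "multinomial_var (Suc n) \<pi> f =
     multinomial_expect n \<pi> (step_var \<pi> f) + multinomial_var n \<pi> (step_mean \<pi> f)"
proof -
  have "step_mean \<pi> (\<lambda>x. (f x)\<^sup>2) = (\<lambda>y. step_var \<pi> f y + (step_mean \<pi> f y)\<^sup>2)"
    by (simp add: fun_eq_iff step_mean_def step_var_def weighted_var_def)
  thus ?thesis
    by (simp add: multinomial_var_def multinomial_expect_Suc multinomial_expect_add)
qed

text \<open>Induction for all \<open>f\<close> at once: the hypothesis is used for
  \<open>step_mean \<pi> f\<close>, whose expected step variance is at most that of \<open>f\<close>
  because \<open>mixed_var\<close> is nonnegative.\<close>

lemma multinomial_efron_stein: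
  assumes "nonneg_probs \<pi>"
  shows "multinomial_var n \<pi> f \<le> real n * multinomial_expect (n - 1) \<pi> (step_var \<pi> f)"
proof (induction n arbitrary: f)
  case 0
  show ?case by (simp add: multinomial_var_def)
next
  case (Suc n)
  \<comment> \<open>For \<open>n = 0\<close> both sides vanish; the truncated \<open>n - 1\<close>
    is harmless under the factor \<open>real n\<close>.\<close>
  have "real n * multinomial_expect (n - 1) \<pi> (step_var \<pi> (step_mean \<pi> f))
      \<le> real n * multinomial_expect n \<pi> (step_var \<pi> f)"
  proof (cases n)
    case (Suc m)
    have "multinomial_expect m \<pi> (step_var \<pi> (step_mean \<pi> f)) =
        multinomial_expect m \<pi> (step_mean \<pi> (step_var \<pi> f)) - multinomial_expect m \<pi> (mixed_var \<pi> f)"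
      by (simp only: step_var_step_mean[abs_def] multinomial_expect_diff)
    moreover have "0 \<le> multinomial_expect m \<pi> (mixed_var \<pi> f)"
      by (intro multinomial_expect_nonneg assms mixed_var_nonneg)
    ultimately show ?thesis using Suc
      by (simp only: multinomial_expect_Suc diff_Suc_1) (simp add: mult_left_mono)
  qed simp
  with Suc.IH[of "step_mean \<pi> f"] show ?case
    by (simp add: multinomial_var_Suc algebra_simps)
qed

text \<open>The induction step once more, with its loss kept instead of dropped. A mixed difference
  takes two trials, hence \<open>n + 2\<close>.\<close>

lemma multinomial_efron_stein_deficit:
  assumes "nonneg_probs \<pi>"
  shows "multinomial_var (n + 2) \<pi> f + real (n + 1) * multinomial_expect n \<pi> (mixed_var \<pi> f)
     \<le> real (n + 2) * multinomial_expect (n + 1) \<pi> (step_var \<pi> f)"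
proof -
  have "multinomial_var (n + 2) \<pi> f =
      multinomial_expect (n + 1) \<pi> (step_var \<pi> f) + multinomial_var (n + 1) \<pi> (step_mean \<pi> f)"
    using multinomial_var_Suc[of "n + 1" \<pi> f] by simp
  also have "multinomial_var (n + 1) \<pi> (step_mean \<pi> f)
      \<le> real (n + 1) * multinomial_expect n \<pi> (step_var \<pi> (step_mean \<pi> f))"
    using multinomial_efron_stein[OF assms, of "n + 1" "step_mean \<pi> f"] by simp
  also have "multinomial_expect n \<pi> (step_var \<pi> (step_mean \<pi> f)) =
      multinomial_expect (n + 1) \<pi> (step_var \<pi> f) - multinomial_expect n \<pi> (mixed_var \<pi> f)"
    by (simp only: step_var_step_mean[abs_def] multinomial_expect_diff)
       (simp add: multinomial_expect_Suc)
  finally show ?thesis by (simp add: algebra_simps)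
qed

text \<open>Equality forces the expected loss to be zero; being nonnegative, the loss vanishes at
  every point of positive mass.\<close>

lemma multinomial_efron_stein_eqD:
  assumes \<pi>: "nonneg_probs \<pi>"
    and eq: "multinomial_var n \<pi> f = real n * multinomial_expect (n - 1) \<pi> (step_var \<pi> f)"
    and "n = m + 2" "0 < multinomial_pmf m \<pi> y"
  shows "mixed_var \<pi> f y = 0"
proof -
  have "real (m + 1) * multinomial_expect m \<pi> (mixed_var \<pi> f) \<le> 0"
    using multinomial_efron_stein_deficit[OF \<pi>, of m f] eq unfolding assms(3) by simp
  hence "multinomial_expect m \<pi> (mixed_var \<pi> f) \<le> 0"
    by (simp add: mult_le_0_iff del: of_nat_add of_nat_Suc)
  moreover have "0 \<le> multinomial_expect m \<pi> (mixed_var \<pi> f)"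
    by (intro multinomial_expect_nonneg \<pi> mixed_var_nonneg)
  ultimately have "multinomial_expect m \<pi> (mixed_var \<pi> f) = 0" by simp
  from multinomial_expect_eq_0D[OF \<pi> mixed_var_nonneg[OF \<pi>] this assms(4)] show ?thesis .
qed

section \<open>Affine functions and vanishing second differences\<close>

definition affine_fun :: "real \<Rightarrow> real ^ 'k \<Rightarrow> nat ^ 'k \<Rightarrow> real" where
  "affine_fun a v x = a + (\<Sum>i\<in>UNIV. v $ i * real (x $ i))"

definition slope :: "real ^ 'k \<Rightarrow> 'k option \<Rightarrow> real" where
  "slope v j = (case j of None \<Rightarrow> 0 | Some i \<Rightarrow> v $ i)"

lemma slope_simps [simp]: "slope v None = 0" "slope v (Some i) = v $ i"
  by (simp_all add: slope_def)

lemma affine_fun_axis: "affine_fun a v (x + axis i 1) = affine_fun a v x + v $ i"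
proof -
  have "(\<Sum>j\<in>UNIV. v $ j * real ((x + axis i 1) $ j)) =
     (\<Sum>j\<in>UNIV. v $ j * real (x $ j) + (if j = i then v $ j else 0))"
    by (rule sum.cong) (auto simp: axis_def algebra_simps)
  thus ?thesis by (simp add: affine_fun_def sum.distrib)
qed

lemma affine_fun_step: "affine_fun a v (x + cell_step j) = slope v j + affine_fun a v x"
  by (cases j) (simp_all add: affine_fun_axis del: One_nat_def)

lemma step_var_affine: "step_var \<pi> (affine_fun a v) y = weighted_var (cell_prob \<pi>) (slope v)"
  by (simp add: step_var_def affine_fun_step weighted_var_shift[OF sum_cell_prob])

lemma step_mean_affine:
  "step_mean \<pi> (affine_fun a v) y = affine_fun a v y + (\<Sum>i\<in>UNIV. \<pi> $ i * v $ i)"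
proof -
  have "step_mean \<pi> (affine_fun a v) y =
      (\<Sum>j\<in>UNIV. cell_prob \<pi> j * slope v j) + sum (cell_prob \<pi>) UNIV * affine_fun a v y"
    by (simp add: step_mean_def affine_fun_step distrib_left sum.distrib sum_distrib_right)
  thus ?thesis by (simp only: sum_cell_prob) (simp add: sum_option)
qed

text \<open>For affine functions \<open>step_var\<close> is constant and \<open>step_mean\<close>
  only adds a constant, so every trial contributes the same variance.\<close>

lemma multinomial_var_affine:
  "multinomial_var n \<pi> (affine_fun a v) = real n * weighted_var (cell_prob \<pi>) (slope v)"
proof (induction n)
  case 0
  show ?case by (simp add: multinomial_var_def)
next
  case (Suc n)
  have "step_mean \<pi> (affine_fun a v) = (\<lambda>y. affine_fun a v y + (\<Sum>i\<in>UNIV. \<pi> $ i * v $ i))"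
    by (simp add: fun_eq_iff step_mean_affine)
  moreover have "step_var \<pi> (affine_fun a v) = (\<lambda>_. weighted_var (cell_prob \<pi>) (slope v))"
    by (simp add: fun_eq_iff step_var_affine)
  ultimately show ?case
    by (simp add: multinomial_var_Suc multinomial_var_add_const Suc algebra_simps)
qed

lemma nat_vec_cases:
  obtains "x = (0 :: nat ^ 'k)" | y i where "x = y + axis i 1"
proof (cases "x = 0")
  case False
  then obtain i where "0 < x $ i" by (auto simp: vec_eq_iff)
  from add_axis_diff[OF this] show ?thesis using that(2) by metis
qed (use that in blast)

text \<open>Discrete integration, twice: first differences become constant, then \<open>f\<close>
  becomes affine. The bound \<open>n\<close> keeps every point in use inside the simplex, as the
  multinomial support requires.\<close>

lemma affine_if_second_differences_vanish:
  assumes "\<And>y i j. total y + 2 \<le> n \<Longrightarrow>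
      f (y + axis i 1 + axis j 1) - f (y + axis i 1) = f (y + axis j 1) - f y"
    and "total x \<le> n"
  shows "f x = affine_fun (f 0) (\<chi> i. f (axis i 1) - f 0) x"
proof -
  have step: "f (y + axis i 1) - f y = f (axis i 1) - f 0" if "total y + 1 \<le> n" for y i
    using that
  proof (induction "total y" arbitrary: y)
    case 0
    hence "y = 0" by (cases y rule: nat_vec_cases) auto
    thus ?case by simp
  next
    case (Suc m)
    then obtain z j where y: "y = z + axis j 1" by (cases y rule: nat_vec_cases) auto
    with Suc have "total z + 2 \<le> n" "m = total z" by auto
    with assms(1)[of z j i] Suc(1)[of z] show ?case unfolding y by simp
  qed
  show ?thesis using assms(2)
  proof (induction "total x" arbitrary: x)
    case 0
    hence "x = 0" by (cases x rule: nat_vec_cases) auto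
    thus ?case by (simp add: affine_fun_def)
  next
    case (Suc m)
    then obtain z j where x: "x = z + axis j 1" by (cases x rule: nat_vec_cases) auto
    with Suc have "total z + 1 \<le> n" "m = total z" by auto
    with step[of z j] Suc(1)[of z] show ?case unfolding x affine_fun_axis by simp
  qed
qed

section \<open>Countable sums of nonnegative terms\<close>

text \<open>Separates equality in a sum of two estimates into equality in each; cancellation in
  \<open>ennreal\<close> is legitimate because the total is finite.\<close>

lemma ennreal_add_eq_addD:
  fixes a b c d :: ennreal
  assumes "a \<le> c" "b \<le> d" "a + b = c + d" "c + d \<noteq> \<infinity>"
  shows "a = c \<and> b = d"
proof -
  have fin: "a \<noteq> \<infinity>" "c \<noteq> \<infinity>" "d \<noteq> \<infinity>"
    using assms by (auto simp: top_unique)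
  have "d + c \<le> d + a"
    using assms(2,3) by (metis add.commute add_left_mono)
  hence "c \<le> a" using fin by (simp add: ennreal_add_left_cancel_le)
  hence "a = c" using assms(1) by simp
  with assms(3) fin show ?thesis by (simp add: ennreal_add_left_cancel)
qed

lemma nn_integral_count_space_compare:
  fixes a b :: "'x \<Rightarrow> real"
  assumes "\<And>x. 0 \<le> a x" "\<And>x. a x \<le> b x"
  shows "(\<integral>\<^sup>+x. ennreal (a x) \<partial>count_space UNIV) \<le> (\<integral>\<^sup>+x. ennreal (b x) \<partial>count_space UNIV)"
  using assms by (intro nn_integral_mono ennreal_leI) auto

text \<open>Write \<open>b\<close> as \<open>a + (b - a)\<close> and cancel the finite integral of
  \<open>a\<close>; the integral of \<open>b - a\<close> is then 0, and counting measure has no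
  nonempty null sets.\<close>

lemma nn_integral_count_space_eqD:
  fixes a b :: "'x \<Rightarrow> real"
  assumes "\<And>x. 0 \<le> a x" "\<And>x. a x \<le> b x"
    and eq: "(\<integral>\<^sup>+x. ennreal (a x) \<partial>count_space UNIV) = (\<integral>\<^sup>+x. ennreal (b x) \<partial>count_space UNIV)"
    and fin: "(\<integral>\<^sup>+x. ennreal (a x) \<partial>count_space UNIV) \<noteq> \<infinity>"
  shows "a x = b x"
proof -
  have "(\<integral>\<^sup>+x. ennreal (b x) \<partial>count_space UNIV) =
      (\<integral>\<^sup>+x. ennreal (a x) + ennreal (b x - a x) \<partial>count_space UNIV)"
    using assms(1,2) by (intro nn_integral_cong) (simp add: ennreal_plus[symmetric] del: ennreal_plus)
  also have "\<dots> = (\<integral>\<^sup>+x. ennreal (a x) \<partial>count_space UNIV) + (\<integral>\<^sup>+x. ennreal (b x - a x) \<partial>count_space UNIV)"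
    by (rule nn_integral_add) auto
  finally have "(\<integral>\<^sup>+x. ennreal (a x) \<partial>count_space UNIV) + (\<integral>\<^sup>+x. ennreal (b x - a x) \<partial>count_space UNIV) =
      (\<integral>\<^sup>+x. ennreal (a x) \<partial>count_space UNIV) + 0"
    unfolding eq[symmetric] by (simp only: add_0_right)
  hence "(\<integral>\<^sup>+x. ennreal (b x - a x) \<partial>count_space UNIV) = 0"
    using fin by (simp only: ennreal_add_left_cancel) simp
  hence "ennreal (b x - a x) = 0"
    by (subst (asm) nn_integral_0_iff_AE) (auto simp: AE_count_space)
  thus ?thesis using assms(2)[of x] by (simp add: ennreal_eq_0_iff)
qed

text \<open>Tonelli for counting measures on arbitrary types, through the integral over
  pairs.\<close>

lemma nn_integral_count_space_swap:
  fixes f :: "'a \<Rightarrow> 'b \<Rightarrow> ennreal"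
  shows "(\<integral>\<^sup>+x. \<integral>\<^sup>+y. f x y \<partial>count_space UNIV \<partial>count_space UNIV) =
    (\<integral>\<^sup>+y. \<integral>\<^sup>+x. f x y \<partial>count_space UNIV \<partial>count_space UNIV)"
  using nn_integral_fst_count_space[of "\<lambda>(x, y). f x y"]
    nn_integral_snd_count_space[of "\<lambda>(x, y). f x y"] by simp

lemma nn_integral_sums:
  assumes "\<And>n. 0 \<le> f n" "f sums s"
  shows "(\<integral>\<^sup>+n. ennreal (f n) \<partial>count_space UNIV) = ennreal s"
  unfolding nn_integral_count_space_nat using assms by (rule suminf_ennreal_eq)

lemma sums_nn_integral:
  assumes "\<And>n. 0 \<le> f n" "(\<integral>\<^sup>+n. ennreal (f n) \<partial>count_space UNIV) = ennreal s" "0 \<le> s"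
  shows "f sums s"
proof -
  have "(\<lambda>n. ennreal (f n)) sums ennreal s"
    using assms(2) unfolding nn_integral_count_space_nat by (metis summableI summable_sums)
  thus ?thesis using assms(1,3) by (simp add: sums_ennreal)
qed

lemma nn_integral_count_space_shift:
  fixes f :: "nat \<Rightarrow> ennreal"
  assumes "f 0 = 0"
  shows "(\<integral>\<^sup>+n. f n \<partial>count_space UNIV) = (\<integral>\<^sup>+n. f (Suc n) \<partial>count_space UNIV)"
  unfolding nn_integral_count_space_nat using suminf_offset[of f 1] assms by simp

section \<open>The negative binomial distribution\<close>

text \<open>For \<open>r > 0\<close>, \<open>pochhammer r n\<close> is
  \<open>Gamma (r + n) / Gamma r\<close>. This is the law of the total of a negative multinomial
  vector whose cell parameters sum to \<open>t\<close>.\<close>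

definition neg_binomial :: "real \<Rightarrow> real \<Rightarrow> nat \<Rightarrow> real" where
  "neg_binomial r t n = pochhammer r n / fact n * t ^ n * (1 - t) powr r"

context
  fixes r t :: real
  assumes r: "0 < r" and t: "0 < t" "t < 1"
begin

lemma neg_binomial_pos: "0 < neg_binomial r t n"
  unfolding neg_binomial_def using r t
  by (intro mult_pos_pos divide_pos_pos pochhammer_pos) auto

text \<open>Binomial series for \<open>(1 - t) powr (- r)\<close>; the signs of the generalized
  binomial coefficients and of \<open>(- t) ^ n\<close> cancel.\<close>

lemma neg_binomial_sums: "neg_binomial r t sums 1"
proof -
  have "(\<lambda>n. ((- r) gchoose n) * (- t) ^ n) sums (1 + - t) powr (- r)"
    using t by (intro gen_binomial_real) auto
  hence "(\<lambda>n. ((- r) gchoose n) * (- t) ^ n * (1 - t) powr r) sums ((1 - t) powr (- r) * (1 - t) powr r)"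
    by (intro sums_mult2) simp
  moreover have "((- r) gchoose n) * (- t) ^ n * (1 - t) powr r = neg_binomial r t n" for n
  proof -
    have "(-1) ^ n * (- t) ^ n = t ^ n"
      by (simp add: power_mult_distrib[symmetric])
    thus ?thesis by (simp add: gbinomial_pochhammer neg_binomial_def mult_ac)
  qed
  moreover have "(1 - t) powr (- r) * (1 - t) powr r = 1"
    using t by (simp flip: powr_add)
  ultimately show ?thesis by simp
qed

text \<open>Size biasing raises the parameter to \<open>r + 1\<close>, by
  \<open>pochhammer r (Suc n) = r * pochhammer (r + 1) n\<close>.\<close>

lemma neg_binomial_Suc:
  "real (Suc n) * neg_binomial r t (Suc n) = r * t / (1 - t) * neg_binomial (r + 1) t n"
proof -
  have "(1 - t) powr (r + 1) = (1 - t) powr r * (1 - t)"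
    using t by (simp add: powr_add)
  moreover have "(fact n :: real) > 0" by simp
  ultimately show ?thesis using t
    unfolding neg_binomial_def pochhammer_rec fact_Suc power_Suc of_nat_mult
    by (simp add: divide_simps del: of_nat_Suc)
qed

text \<open>The negative multinomial weight depends on the total only, so this identity carries its
  change from \<open>r\<close> to \<open>r + 1\<close>. It compares the two recursions for
  \<open>pochhammer r (Suc n)\<close>.\<close>

lemma neg_binomial_weight:
  "neg_binomial r t n * ((1 - t) * (r + real n) / r) = neg_binomial (r + 1) t n"
proof -
  have "(1 - t) powr (r + 1) = (1 - t) powr r * (1 - t)"
    using t by (simp add: powr_add)
  moreover have "pochhammer r n * (r + real n) = r * pochhammer (r + 1) n"
    using pochhammer_rec[of r n] pochhammer_rec'[of r n] by (simp add: mult.commute)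
  hence "pochhammer (r + 1) n = pochhammer r n * (r + real n) / r"
    using r by (simp add: field_simps)
  ultimately show ?thesis
    by (simp add: neg_binomial_def mult_ac)
qed

end

section \<open>A Poincare inequality for the negative binomial distribution\<close>

context
  fixes r t :: real
  assumes r: "0 < r" and t: "0 < t" "t < 1"
begin

text \<open>
  The partial sum over \<open>m \<le> k\<close> of \<open>(\<mu> - m) p(m)\<close>, where \<open>\<mu>\<close> is the mean of \<open>p = neg_binomial r t\<close>;
  see \<open>nb_kernel_lower_sum\<close>.
\<close>

definition nb_kernel :: "nat \<Rightarrow> real" where
  "nb_kernel k = r * t / (1 - t)\<^sup>2 * neg_binomial (r + 1) t k"

lemma nb_kernel_pos: "0 < nb_kernel k"
  unfolding nb_kernel_def using r t neg_binomial_pos[of "r + 1" t k] by simp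

lemma neg_binomial_mean: "(\<lambda>n. real n * neg_binomial r t n) sums (r * t / (1 - t))"
proof -
  have "(\<lambda>n. real (Suc n) * neg_binomial r t (Suc n)) sums (r * t / (1 - t) * 1)"
    unfolding neg_binomial_Suc[OF r t] using r t by (intro sums_mult neg_binomial_sums) auto
  thus ?thesis by (subst (asm) sums_Suc_iff) simp
qed

text \<open>Together with \<open>nb_kernel_Suc\<close> this writes the kernel through the mass at
  \<open>k\<close> and through the mass at \<open>k + 1\<close>; comparing the two forms is the
  induction step for \<open>nb_kernel_lower_sum\<close>.\<close>

lemma nb_kernel_eq: "nb_kernel k = t * (r + real k) / (1 - t) * neg_binomial r t k"
  unfolding nb_kernel_def neg_binomial_weight[OF r t, of k, symmetric]
  using r t by (simp add: power2_eq_square divide_simps)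

lemma nb_kernel_Suc: "nb_kernel k = real (Suc k) / (1 - t) * neg_binomial r t (Suc k)"
proof -
  have "nb_kernel k = (r * t / (1 - t) * neg_binomial (r + 1) t k) / (1 - t)"
    by (simp add: nb_kernel_def power2_eq_square)
  thus ?thesis unfolding neg_binomial_Suc[OF r t, symmetric] by simp
qed

lemma nb_kernel_lower_sum:
  "(\<Sum>m\<le>k. (r * t / (1 - t) - real m) * neg_binomial r t m) = nb_kernel k"
proof (induction k)
  case 0
  show ?case by (simp add: nb_kernel_eq)
next
  case (Suc k)
  have "real (Suc k) / (1 - t) + (r * t / (1 - t) - real (Suc k)) = t * (r + real (Suc k)) / (1 - t)"
    using t by (simp add: divide_simps) (simp add: algebra_simps)
  thus ?case
    unfolding sum.atMost_Suc Suc nb_kernel_eq[of "Suc k"] unfolding nb_kernel_Suc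
    by (simp only: distrib_right[symmetric])
qed

lemma sums_tail:
  fixes f :: "nat \<Rightarrow> real"
  assumes "f sums s"
  shows "(\<lambda>n. if k < n then f n else 0) sums (s - sum f {..k})"
proof -
  have "(\<lambda>n. f n - (if n \<in> {..k} then f n else 0)) sums (s - sum f {..k})"
    by (intro sums_diff assms sums_If_finite_set) simp
  moreover have "(\<lambda>n. f n - (if n \<in> {..k} then f n else 0)) = (\<lambda>n. if k < n then f n else 0)"
    by auto
  ultimately show ?thesis by simp
qed

text \<open>Split \<open>n - m\<close> as \<open>(n - mu) + (mu - m)\<close>. The tail sum of the
  first and the lower sum of the second both equal \<open>nb_kernel k\<close>, and they get
  multiplied by the masses of \<open>{..k}\<close> and of its complement, which add up to 1.\<close>

lemma nb_kernel_pairs: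
  "(\<integral>\<^sup>+m. \<integral>\<^sup>+n. ennreal (if m \<le> k \<and> k < n then
      neg_binomial r t m * neg_binomial r t n * (real n - real m) else 0)
     \<partial>count_space UNIV \<partial>count_space UNIV) = ennreal (nb_kernel k)"
proof -
  let ?p = "neg_binomial r t"
  define mu where "mu = r * t / (1 - t)"
  define T where "T = 1 - (\<Sum>m\<le>k. ?p m)"
  have tail1: "(\<lambda>n. if k < n then ?p n else 0) sums T"
    unfolding T_def by (intro sums_tail neg_binomial_sums r t)
  \<comment> \<open>The deviations \<open>real n - mu\<close> sum to 0, so their tail beyond
    \<open>k\<close> equals the lower sum of \<open>mu - real m\<close>.\<close>
  have "(\<lambda>n. real n * ?p n - mu * ?p n) sums (mu - mu * 1)"
    by (intro sums_diff neg_binomial_mean[folded mu_def] sums_mult neg_binomial_sums r t)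
  hence "(\<lambda>n. (real n - mu) * ?p n) sums 0" by (simp add: left_diff_distrib)
  from sums_tail[OF this, of k]
  have tail2: "(\<lambda>n. if k < n then (real n - mu) * ?p n else 0) sums nb_kernel k"
    unfolding nb_kernel_lower_sum[folded mu_def, symmetric] by (simp add: sum_negf[symmetric] algebra_simps)
  define G where "G = (\<lambda>m. ?p m * (nb_kernel k + (mu - real m) * T))"
  have inner: "(\<integral>\<^sup>+n. ennreal (if m \<le> k \<and> k < n then ?p m * ?p n * (real n - real m) else 0) \<partial>count_space UNIV)
      = ennreal (if m \<in> {..k} then G m else 0) \<and> 0 \<le> (if m \<in> {..k} then G m else 0)" for m
  proof (cases "m \<le> k")
    case True
    have "(\<lambda>n. ?p m * ((if k < n then (real n - mu) * ?p n else 0) +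
        (mu - real m) * (if k < n then ?p n else 0))) sums G m"
      unfolding G_def by (intro sums_mult sums_add tail1 tail2)
    also have "(\<lambda>n. ?p m * ((if k < n then (real n - mu) * ?p n else 0) +
        (mu - real m) * (if k < n then ?p n else 0))) =
      (\<lambda>n. if m \<le> k \<and> k < n then ?p m * ?p n * (real n - real m) else 0)"
      using True by (auto simp: algebra_simps)
    finally have s: "(\<lambda>n. if m \<le> k \<and> k < n then ?p m * ?p n * (real n - real m) else 0) sums G m" .
    have nn: "0 \<le> (if m \<le> k \<and> k < n then ?p m * ?p n * (real n - real m) else 0)" for n
      using neg_binomial_pos[OF r t, of m] neg_binomial_pos[OF r t, of n] by simp
    have "0 \<le> G m"
      using sums_le[OF _ sums_zero s] nn by simp
    with nn_integral_sums[OF nn s] True show ?thesis by simp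
  qed simp
  have "(\<lambda>m. if m \<in> {..k} then G m else 0) sums sum G {..k}"
    by (rule sums_If_finite_set) simp
  also have "sum G {..k} = nb_kernel k * (\<Sum>m\<le>k. ?p m) + T * (\<Sum>m\<le>k. (mu - real m) * ?p m)"
    unfolding sum_distrib_left sum.distrib[symmetric] G_def
    by (intro sum.cong refl) (simp add: algebra_simps)
  also have "\<dots> = nb_kernel k"
    unfolding nb_kernel_lower_sum[folded mu_def] T_def by (simp add: algebra_simps)
  finally have outer: "(\<lambda>m. if m \<in> {..k} then G m else 0) sums nb_kernel k" .
  show ?thesis
    using nn_integral_sums[OF _ outer] inner by (simp del: atMost_iff)
qed

text \<open>Expand \<open>h n - h m\<close> around \<open>c\<close>: since \<open>c\<close> is the
  mean, the cross term drops out and the sum over all pairs is \<open>2 * v\<close>. By symmetry the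
  pairs \<open>m < n\<close> carry half of it.\<close>

lemma pair_variance:
  fixes h :: "nat \<Rightarrow> real"
  assumes c: "(\<lambda>n. neg_binomial r t n * h n) sums c"
    and v: "(\<lambda>n. neg_binomial r t n * (h n - c)\<^sup>2) sums v"
  shows "(\<integral>\<^sup>+m. \<integral>\<^sup>+n. ennreal (if m < n then neg_binomial r t m * neg_binomial r t n * (h n - h m)\<^sup>2 else 0)
     \<partial>count_space UNIV \<partial>count_space UNIV) = ennreal v" (is "?L = _")
proof -
  let ?p = "neg_binomial r t"
  have p: "0 < ?p n" for n by (rule neg_binomial_pos[OF r t])
  have "0 \<le> ?p n * (h n - c)\<^sup>2" for n
    using p[of n] by simp
  from sums_le[OF this sums_zero v] have v0: "0 \<le> v" .
  have inner: "(\<lambda>n. ?p m * ?p n * (h n - h m)\<^sup>2) sums (?p m * (h m - c)\<^sup>2 + v * ?p m)" for m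
  proof -
    have "(\<lambda>n. ?p n * h n - c * ?p n) sums (c - c * 1)"
      by (intro sums_diff c sums_mult neg_binomial_sums r t)
    from this v neg_binomial_sums[OF r t] have "(\<lambda>n. ?p m * (?p n * (h n - c)\<^sup>2 + (2 * (c - h m)) * (?p n * h n - c * ?p n) + (h m - c)\<^sup>2 * ?p n))
       sums (?p m * (v + (2 * (c - h m)) * (c - c * 1) + (h m - c)\<^sup>2 * 1))"
      by (intro sums_mult sums_add)
    moreover have "(\<lambda>n. ?p m * (?p n * (h n - c)\<^sup>2 + (2 * (c - h m)) * (?p n * h n - c * ?p n) + (h m - c)\<^sup>2 * ?p n))
        = (\<lambda>n. ?p m * ?p n * (h n - h m)\<^sup>2)"
      by (simp add: fun_eq_iff power2_eq_square algebra_simps)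
    moreover have "?p m * (v + (2 * (c - h m)) * (c - c * 1) + (h m - c)\<^sup>2 * 1) = ?p m * (h m - c)\<^sup>2 + v * ?p m"
      by (simp add: algebra_simps)
    ultimately show ?thesis by (simp only:)
  qed
  have total: "(\<lambda>m. ?p m * (h m - c)\<^sup>2 + v * ?p m) sums (v + v * 1)"
    using v neg_binomial_sums[OF r t] by (intro sums_add sums_mult)
  have nonneg: "0 \<le> ?p m * (h m - c)\<^sup>2 + v * ?p m" for m
    using p[of m] v0 by simp
  have "(\<integral>\<^sup>+m. ennreal (?p m * (h m - c)\<^sup>2 + v * ?p m) \<partial>count_space UNIV) = ennreal (2 * v)"
    using nn_integral_sums[OF nonneg total] by simp
  also have "(\<integral>\<^sup>+m. ennreal (?p m * (h m - c)\<^sup>2 + v * ?p m) \<partial>count_space UNIV) =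
      (\<integral>\<^sup>+m. \<integral>\<^sup>+n. ennreal (?p m * ?p n * (h n - h m)\<^sup>2) \<partial>count_space UNIV \<partial>count_space UNIV)"
  proof (rule nn_integral_cong)
    fix m
    have "0 \<le> ?p m * ?p n * (h n - h m)\<^sup>2" for n
      using p[of m] p[of n] by simp
    from nn_integral_sums[OF this inner]
    show "ennreal (?p m * (h m - c)\<^sup>2 + v * ?p m) = (\<integral>\<^sup>+n. ennreal (?p m * ?p n * (h n - h m)\<^sup>2) \<partial>count_space UNIV)" ..
  qed
  also have "\<dots> = (\<integral>\<^sup>+m. (\<integral>\<^sup>+n. ennreal (if m < n then ?p m * ?p n * (h n - h m)\<^sup>2 else 0) \<partial>count_space UNIV) +
      (\<integral>\<^sup>+n. ennreal (if n < m then ?p n * ?p m * (h m - h n)\<^sup>2 else 0) \<partial>count_space UNIV) \<partial>count_space UNIV)"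
  proof (rule nn_integral_cong)
    fix m :: nat
    have *: "ennreal (?p m * ?p n * (h n - h m)\<^sup>2) =
        ennreal (if m < n then ?p m * ?p n * (h n - h m)\<^sup>2 else 0) +
        ennreal (if n < m then ?p n * ?p m * (h m - h n)\<^sup>2 else 0)" for n
      by (cases m n rule: linorder_cases) (simp_all add: power2_commute[of "h n"] mult.commute)
    show "(\<integral>\<^sup>+n. ennreal (?p m * ?p n * (h n - h m)\<^sup>2) \<partial>count_space UNIV) =
        (\<integral>\<^sup>+n. ennreal (if m < n then ?p m * ?p n * (h n - h m)\<^sup>2 else 0) \<partial>count_space UNIV) +
        (\<integral>\<^sup>+n. ennreal (if n < m then ?p n * ?p m * (h m - h n)\<^sup>2 else 0) \<partial>count_space UNIV)"
      unfolding * by (rule nn_integral_add) auto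
  qed
  also have "\<dots> = ?L + (\<integral>\<^sup>+m. \<integral>\<^sup>+n. ennreal (if n < m then ?p n * ?p m * (h m - h n)\<^sup>2 else 0)
      \<partial>count_space UNIV \<partial>count_space UNIV)"
    by (rule nn_integral_add) auto
  also have "\<dots> = ?L + ?L"
    using nn_integral_count_space_swap[of "\<lambda>m n. ennreal (if m < n then ?p m * ?p n * (h n - h m)\<^sup>2 else 0)"]
    by (simp only:)
  finally have "?L + ?L = ennreal (2 * v)" .
  moreover have "ennreal (2 * v) = 2 * ennreal v"
    using v0 by (simp add: ennreal_mult)
  ultimately have "2 * ?L = 2 * ennreal v" by (simp only: mult_2[of "?L"])
  thus ?thesis by (simp only: ennreal_mult_cancel_left) simp
qed

lemma sum_square_diff_le:
  fixes h :: "nat \<Rightarrow> real"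
  assumes "m < n"
  shows "(h n - h m)\<^sup>2 \<le> (real n - real m) * (\<Sum>k\<in>{m..<n}. (h (Suc k) - h k)\<^sup>2)"
proof -
  have "h n - h m = (\<Sum>k\<in>{m..<n}. h (Suc k) - h k)"
    using assms by (simp add: sum_Suc_diff')
  also have "(\<Sum>k\<in>{m..<n}. h (Suc k) - h k)\<^sup>2 \<le> (\<Sum>k\<in>{m..<n}. (h (Suc k) - h k)\<^sup>2) * card {m..<n}"
    by (rule sum_squared_le_sum_of_squares)
  finally show ?thesis using assms by (simp add: of_nat_diff mult.commute)
qed

text \<open>Cauchy-Schwarz majorant of the terms in \<open>pair_variance\<close>. It is a function
  on pairs so that equality of the integrals can be read off pair by pair.\<close>

definition pair_bound :: "(nat \<Rightarrow> real) \<Rightarrow> nat \<times> nat \<Rightarrow> real" where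
  "pair_bound h = (\<lambda>(m, n). if m < n then neg_binomial r t m * neg_binomial r t n *
     ((real n - real m) * (\<Sum>k\<in>{m..<n}. (h (Suc k) - h k)\<^sup>2)) else 0)"

text \<open>Exchange the sums so that \<open>k\<close> is outermost: the increment at
  \<open>k\<close> is met exactly by the pairs \<open>m \<le> k < n\<close>, whose total weight is
  \<open>nb_kernel k\<close>.\<close>

lemma pair_bound_integral:
  "(\<integral>\<^sup>+x. ennreal (pair_bound h x) \<partial>count_space UNIV) =
    (\<integral>\<^sup>+k. ennreal (nb_kernel k * (h (Suc k) - h k)\<^sup>2) \<partial>count_space UNIV)"
proof -
  let ?p = "neg_binomial r t"
  let ?K = "\<lambda>k m n. if m \<le> k \<and> k < n then ?p m * ?p n * (real n - real m) else 0"
  have K: "0 \<le> ?K k m n" for k m n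
    using neg_binomial_pos[OF r t, of m] neg_binomial_pos[OF r t, of n] by simp
  have "(\<integral>\<^sup>+k. ennreal (nb_kernel k * (h (Suc k) - h k)\<^sup>2) \<partial>count_space UNIV) =
      (\<integral>\<^sup>+k. \<integral>\<^sup>+m. \<integral>\<^sup>+n. ennreal (?K k m n * (h (Suc k) - h k)\<^sup>2)
        \<partial>count_space UNIV \<partial>count_space UNIV \<partial>count_space UNIV)"
  proof (rule nn_integral_cong)
    fix k :: nat
    have "ennreal (nb_kernel k * (h (Suc k) - h k)\<^sup>2) = (\<integral>\<^sup>+m. \<integral>\<^sup>+n. ennreal (?K k m n) \<partial>count_space UNIV \<partial>count_space UNIV) * ennreal ((h (Suc k) - h k)\<^sup>2)"
      using nb_kernel_pos[of k] unfolding nb_kernel_pairs by (simp add: ennreal_mult)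
    also have "\<dots> = (\<integral>\<^sup>+m. \<integral>\<^sup>+n. ennreal (?K k m n * (h (Suc k) - h k)\<^sup>2) \<partial>count_space UNIV \<partial>count_space UNIV)"
      by (simp add: nn_integral_multc[symmetric] ennreal_mult K del: if_split)
    finally show "ennreal (nb_kernel k * (h (Suc k) - h k)\<^sup>2) = \<dots>" .
  qed
  also have "\<dots> = (\<integral>\<^sup>+m. \<integral>\<^sup>+k. \<integral>\<^sup>+n. ennreal (?K k m n * (h (Suc k) - h k)\<^sup>2)
        \<partial>count_space UNIV \<partial>count_space UNIV \<partial>count_space UNIV)"
    by (rule nn_integral_count_space_swap)
  also have "\<dots> = (\<integral>\<^sup>+m. \<integral>\<^sup>+n. \<integral>\<^sup>+k. ennreal (?K k m n * (h (Suc k) - h k)\<^sup>2)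
        \<partial>count_space UNIV \<partial>count_space UNIV \<partial>count_space UNIV)"
    by (intro nn_integral_cong nn_integral_count_space_swap)
  also have "\<dots> = (\<integral>\<^sup>+m. \<integral>\<^sup>+n. ennreal (pair_bound h (m, n)) \<partial>count_space UNIV \<partial>count_space UNIV)"
  proof (intro nn_integral_cong)
    fix m n :: nat
    have "(\<integral>\<^sup>+k. ennreal (?K k m n * (h (Suc k) - h k)\<^sup>2) \<partial>count_space UNIV) =
        (\<Sum>k\<in>{m..<n}. ennreal (?K k m n * (h (Suc k) - h k)\<^sup>2))"
      by (rule nn_integral_count_space') auto
    also have "\<dots> = ennreal (\<Sum>k\<in>{m..<n}. ?K k m n * (h (Suc k) - h k)\<^sup>2)"
      by (rule sum_ennreal) (intro mult_nonneg_nonneg K zero_le_power2)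
    also have "(\<Sum>k\<in>{m..<n}. ?K k m n * (h (Suc k) - h k)\<^sup>2) = pair_bound h (m, n)"
      by (auto simp: pair_bound_def sum_distrib_left mult.assoc intro!: sum.cong)
    finally show "(\<integral>\<^sup>+k. ennreal (?K k m n * (h (Suc k) - h k)\<^sup>2) \<partial>count_space UNIV) =
        ennreal (pair_bound h (m, n))" .
  qed
  also have "\<dots> = (\<integral>\<^sup>+x. ennreal (pair_bound h x) \<partial>count_space UNIV)"
    by (rule nn_integral_fst_count_space)
  finally show ?thesis ..
qed

text \<open>Both sides are sums over pairs \<open>m < n\<close>, compared term by term; as all
  masses are positive and \<open>v\<close> is finite, equality forces equality in every single
  Cauchy-Schwarz estimate.\<close>

theorem neg_binomial_poincare:
  fixes h :: "nat \<Rightarrow> real"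
  assumes c: "(\<lambda>n. neg_binomial r t n * h n) sums c"
    and v: "(\<lambda>n. neg_binomial r t n * (h n - c)\<^sup>2) sums v"
  shows "ennreal v \<le> (\<integral>\<^sup>+k. ennreal (nb_kernel k * (h (Suc k) - h k)\<^sup>2) \<partial>count_space UNIV)"
    and "ennreal v = (\<integral>\<^sup>+k. ennreal (nb_kernel k * (h (Suc k) - h k)\<^sup>2) \<partial>count_space UNIV) \<longleftrightarrow>
      (\<exists>d. \<forall>k. h (Suc k) - h k = d)"
proof -
  let ?p = "neg_binomial r t"
  have p: "0 < ?p n" for n by (rule neg_binomial_pos[OF r t])
  define A where "A = (\<lambda>(m, n). if m < n then ?p m * ?p n * (h n - h m)\<^sup>2 else 0)"
  have A: "(\<integral>\<^sup>+x. ennreal (A x) \<partial>count_space UNIV) = ennreal v"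
    using nn_integral_fst_count_space[of "\<lambda>x. ennreal (A x)"] pair_variance[OF c v] by (simp add: A_def)
  have A0: "0 \<le> A x" for x using p by (auto simp: A_def less_imp_le split: prod.splits)
  have AB: "A x \<le> pair_bound h x" for x
    using p sum_square_diff_le[of _ _ h]
    by (auto simp: A_def pair_bound_def less_imp_le intro!: mult_left_mono split: prod.splits)
  show "ennreal v \<le> (\<integral>\<^sup>+k. ennreal (nb_kernel k * (h (Suc k) - h k)\<^sup>2) \<partial>count_space UNIV)"
    using nn_integral_count_space_compare[of A "pair_bound h", OF A0 AB] unfolding A pair_bound_integral .
  show "ennreal v = (\<integral>\<^sup>+k. ennreal (nb_kernel k * (h (Suc k) - h k)\<^sup>2) \<partial>count_space UNIV) \<longleftrightarrow>
      (\<exists>d. \<forall>k. h (Suc k) - h k = d)"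
  proof
    assume "ennreal v = (\<integral>\<^sup>+k. ennreal (nb_kernel k * (h (Suc k) - h k)\<^sup>2) \<partial>count_space UNIV)"
    hence "(\<integral>\<^sup>+x. ennreal (A x) \<partial>count_space UNIV) = (\<integral>\<^sup>+x. ennreal (pair_bound h x) \<partial>count_space UNIV)"
      unfolding A pair_bound_integral .
    hence AB_eq: "A x = pair_bound h x" for x
      by (rule nn_integral_count_space_eqD[of A "pair_bound h", OF A0 AB]) (simp add: A)
    \<comment> \<open>The pair \<open>(k, k + 2)\<close> suffices: for two consecutive increments
      \<open>a\<close> and \<open>b\<close>, equality reads
      \<open>(a + b)^2 = 2 * (a^2 + b^2)\<close>, that is \<open>a = b\<close>.\<close>
    have step: "h (Suc (Suc k)) - h (Suc k) = h (Suc k) - h k" for k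
    proof -
      have "?p k * ?p (Suc (Suc k)) * (h (Suc (Suc k)) - h k)\<^sup>2 =
          ?p k * ?p (Suc (Suc k)) * (2 * ((h (Suc k) - h k)\<^sup>2 + (h (Suc (Suc k)) - h (Suc k))\<^sup>2))"
        using AB_eq[of "(k, Suc (Suc k))"] by (simp add: A_def pair_bound_def)
      hence "(h (Suc (Suc k)) - h k)\<^sup>2 = 2 * ((h (Suc k) - h k)\<^sup>2 + (h (Suc (Suc k)) - h (Suc k))\<^sup>2)"
        using p[of k] p[of "Suc (Suc k)"] by simp
      moreover have "((h (Suc (Suc k)) - h (Suc k)) - (h (Suc k) - h k))\<^sup>2 =
          2 * ((h (Suc k) - h k)\<^sup>2 + (h (Suc (Suc k)) - h (Suc k))\<^sup>2) - (h (Suc (Suc k)) - h k)\<^sup>2"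
        by (simp add: power2_eq_square algebra_simps)
      ultimately have "((h (Suc (Suc k)) - h (Suc k)) - (h (Suc k) - h k))\<^sup>2 = 0" by linarith
      thus ?thesis by simp
    qed
    have "h (Suc k) - h k = h (Suc 0) - h 0" for k
      by (induction k) (simp_all only: step)
    thus "\<exists>d. \<forall>k. h (Suc k) - h k = d" by blast
  next
    assume "\<exists>d. \<forall>k. h (Suc k) - h k = d"
    then obtain d where const: "h (Suc k) - h k = d" for k by blast
    have h: "h n = h 0 + real n * d" for n
    proof (induction n)
      case (Suc n)
      with const[of n] show ?case by (simp add: algebra_simps)
    qed simp
    have "A x = pair_bound h x" for x
    proof (cases x)
      case (Pair m n)
      have "h n - h m = (real n - real m) * d"
        unfolding h[of n] h[of m] by (simp add: algebra_simps)
      with const Pair show ?thesis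
        by (auto simp: A_def pair_bound_def of_nat_diff power2_eq_square)
    qed
    hence "A = pair_bound h" by blast
    thus "ennreal v = (\<integral>\<^sup>+k. ennreal (nb_kernel k * (h (Suc k) - h k)\<^sup>2) \<partial>count_space UNIV)"
      using A pair_bound_integral by simp
  qed
qed

end

section \<open>Random vectors with a given probability mass function\<close>

lemma has_pmf_nn_integral:
  assumes "has_pmf M X p"
  shows "(\<integral>\<^sup>+\<omega>. F (X \<omega>) \<partial>M) = (\<integral>\<^sup>+x. ennreal (p x) * F x \<partial>count_space UNIV)"
  using assms unfolding has_pmf_def by (intro distributed_nn_integral[symmetric]) auto

lemma has_pmf_measurable:
  fixes F :: "nat ^ 'k \<Rightarrow> real"
  assumes "has_pmf M X p"
  shows "(\<lambda>\<omega>. F (X \<omega>)) \<in> borel_measurable M"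
proof -
  have "X \<in> measurable M (count_space UNIV)"
    using assms unfolding has_pmf_def by (rule distributed_measurable)
  thus ?thesis by (rule measurable_compose) simp
qed

lemma finite_varianceI:
  assumes "prob_space M" "Y \<in> borel_measurable M" "(\<integral>\<^sup>+\<omega>. ennreal ((Y \<omega>)\<^sup>2) \<partial>M) < \<infinity>"
  shows "finite_variance M Y"
proof -
  interpret prob_space M by fact
  have sq: "integrable M (\<lambda>\<omega>. (Y \<omega>)\<^sup>2)"
    using assms(2,3) by (intro integrableI_nonneg) auto
  have int: "integrable M Y"
    using square_integrable_imp_integrable[OF assms(2) sq] .
  have "integrable M (\<lambda>\<omega>. (Y \<omega>)\<^sup>2 - 2 * c * Y \<omega> + c\<^sup>2)" for c
    using sq int by simp
  hence "integrable M (\<lambda>\<omega>. (Y \<omega> - c)\<^sup>2)" for c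
    by (simp add: power2_diff mult.assoc mult.commute mult.left_commute algebra_simps)
  thus ?thesis using int by (simp add: finite_variance_def)
qed

lemma variance_of_nonneg: "0 \<le> variance_of M Y"
  by (simp add: variance_of_def)

text \<open>Bilinearity of the covariance. The finite sums may leave the integral because products
  of centred components are dominated by sums of their squares.\<close>

lemma covariance_matrix_quadratic_form:
  fixes Z :: "'a \<Rightarrow> real ^ 'k"
  assumes fin: "\<And>i. finite_variance M (\<lambda>\<omega>. Z \<omega> $ i)"
  shows "v \<bullet> (covariance_matrix M Z *v v) = variance_of M (\<lambda>\<omega>. \<Sum>i\<in>UNIV. v $ i * Z \<omega> $ i)"
proof -
  define Y where "Y = (\<lambda>i \<omega>. Z \<omega> $ i - (\<integral>\<omega>'. Z \<omega>' $ i \<partial>M))"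
  have int: "integrable M (\<lambda>\<omega>. Z \<omega> $ i)" for i
    using fin[of i] by (simp add: finite_variance_def)
  have sq: "integrable M (\<lambda>\<omega>. (Y i \<omega>)\<^sup>2)" for i
    using fin[of i] by (simp add: finite_variance_def Y_def)
  have meas: "Y i \<in> borel_measurable M" for i
    using borel_measurable_integrable[OF int[of i]] unfolding Y_def by simp
  have prod: "integrable M (\<lambda>\<omega>. Y i \<omega> * Y j \<omega>)" for i j
  proof (rule Bochner_Integration.integrable_bound)
    show "integrable M (\<lambda>\<omega>. (Y i \<omega>)\<^sup>2 + (Y j \<omega>)\<^sup>2)" using sq by simp
    show "(\<lambda>\<omega>. Y i \<omega> * Y j \<omega>) \<in> borel_measurable M" using meas by simp
    have "\<bar>a * b\<bar> \<le> a\<^sup>2 + b\<^sup>2" for a b :: real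
    proof -
      have "2 * (\<bar>a\<bar> * \<bar>b\<bar>) \<le> a\<^sup>2 + b\<^sup>2"
        using sum_squares_bound[of "\<bar>a\<bar>" "\<bar>b\<bar>"] by simp
      moreover have "0 \<le> \<bar>a\<bar> * \<bar>b\<bar>" by simp
      ultimately show ?thesis unfolding abs_mult by linarith
    qed
    thus "AE \<omega> in M. norm (Y i \<omega> * Y j \<omega>) \<le> norm ((Y i \<omega>)\<^sup>2 + (Y j \<omega>)\<^sup>2)"
      by simp
  qed
  have "v \<bullet> (covariance_matrix M Z *v v) =
      (\<Sum>i\<in>UNIV. \<Sum>j\<in>UNIV. (\<integral>\<omega>. v $ i * v $ j * (Y i \<omega> * Y j \<omega>) \<partial>M))"
    unfolding inner_vec_def matrix_vector_mult_def covariance_matrix_def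
    by (simp add: Y_def sum_distrib_left mult_ac)
  also have "\<dots> = (\<integral>\<omega>. (\<Sum>i\<in>UNIV. \<Sum>j\<in>UNIV. v $ i * v $ j * (Y i \<omega> * Y j \<omega>)) \<partial>M)"
    using prod by (simp add: Bochner_Integration.integral_sum Bochner_Integration.integrable_sum)
  also have "\<dots> = (\<integral>\<omega>. (\<Sum>i\<in>UNIV. v $ i * Y i \<omega>)\<^sup>2 \<partial>M)"
    by (simp add: power2_eq_square sum_product mult_ac)
  also have "\<dots> = variance_of M (\<lambda>\<omega>. \<Sum>i\<in>UNIV. v $ i * Z \<omega> $ i)"
    unfolding variance_of_def using int
    by (simp add: Y_def Bochner_Integration.integral_sum sum_subtractf right_diff_distrib)
  finally show ?thesis .
qed

section \<open>Discrete gradients and the weighted bound\<close>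

lemma real_vec_add_axis: "real_vec (x + axis i 1) = real_vec x + axis i 1"
  by (auto simp: real_vec_def vec_eq_iff axis_def)

lemma slope_discrete_gradient:
  "slope (discrete_gradient g (real_vec x)) j = g (real_vec (x + cell_step j)) - g (real_vec x)"
  by (cases j) (simp_all add: discrete_gradient_def real_vec_add_axis del: One_nat_def)

text \<open>The slopes are the values of \<open>g\<close> after one step, shifted by the constant
  \<open>g (real_vec x)\<close>. This is the link from the quadratic form to the Efron-Stein
  term.\<close>

lemma step_var_discrete_gradient:
  "weighted_var (cell_prob \<pi>) (slope (discrete_gradient g (real_vec x))) =
     step_var \<pi> (\<lambda>x. g (real_vec x)) x"
  unfolding step_var_def slope_discrete_gradient
  using weighted_var_shift[OF sum_cell_prob, of \<pi> "\<lambda>j. g (real_vec (x + cell_step j))" "- g (real_vec x)"]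
  by simp

lemma step_mean_discrete_gradient:
  "(\<Sum>j\<in>UNIV. cell_prob \<pi> j * slope (discrete_gradient g (real_vec x)) j) =
     step_mean \<pi> (\<lambda>x. g (real_vec x)) x - g (real_vec x)"
  unfolding step_mean_def slope_discrete_gradient
  by (simp add: right_diff_distrib sum_subtractf sum_distrib_right[symmetric] sum_cell_prob)

lemma linear_on_support_iff:
  "linear_on_support g S \<longleftrightarrow> (\<exists>a v. \<forall>x\<in>S. g (real_vec x) = affine_fun a v x)"
  by (simp add: linear_on_support_def affine_fun_def)

text \<open>Common reduction of both cases: \<open>B v\<close> is the quadratic form of the
  covariance matrix and \<open>p'\<close> the reweighted law. Negative values of \<open>w\<close> do
  no harm, since multiplication by the nonnegative \<open>p\<close> and \<open>B\<close> commutes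
  with the truncation in \<open>ennreal\<close>.\<close>

lemma weighted_gradient_bound_eq:
  fixes X :: "'a \<Rightarrow> nat ^ 'k"
  assumes X: "has_pmf M X p"
    and fin: "\<And>v. finite_variance M (\<lambda>\<omega>. affine_fun 0 v (X \<omega>))"
    and B: "\<And>v. variance_of M (\<lambda>\<omega>. affine_fun 0 v (X \<omega>)) = B v"
    and p: "\<And>x. 0 \<le> p x"
    and w: "\<And>x. p x * w (real_vec x) = p' x"
  shows "weighted_gradient_bound M (\<lambda>\<omega>. real_vec (X \<omega>)) w g =
    (\<integral>\<^sup>+x. ennreal (p' x) * ennreal (B (discrete_gradient g (real_vec x))) \<partial>count_space UNIV)"
proof -
  have lin: "affine_fun 0 v (X \<omega>) = (\<Sum>i\<in>UNIV. v $ i * real_vec (X \<omega>) $ i)" for v \<omega>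
    by (simp add: affine_fun_def real_vec_def)
  have comp: "affine_fun 0 (axis i 1) (X \<omega>) = real_vec (X \<omega>) $ i" for i \<omega>
  proof -
    have "(\<Sum>j\<in>UNIV. axis i 1 $ j * real_vec (X \<omega>) $ j) =
        (\<Sum>j\<in>UNIV. if j = i then real_vec (X \<omega>) $ j else 0)"
      by (rule sum.cong) (auto simp: axis_def)
    thus ?thesis unfolding lin by simp
  qed
  have "finite_variance M (\<lambda>\<omega>. real_vec (X \<omega>) $ i)" for i
    using fin[of "axis i 1"] unfolding comp .
  from covariance_matrix_quadratic_form[of M "\<lambda>\<omega>. real_vec (X \<omega>)", OF this]
  have quad: "v \<bullet> (covariance_matrix M (\<lambda>\<omega>. real_vec (X \<omega>)) *v v) = B v" for v
    using B[of v] unfolding lin by simp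
  have B0: "0 \<le> B v" for v
    using B[of v] variance_of_nonneg by metis
  have "weighted_gradient_bound M (\<lambda>\<omega>. real_vec (X \<omega>)) w g =
      (\<integral>\<^sup>+x. ennreal (p x) * ennreal (w (real_vec x) * B (discrete_gradient g (real_vec x))) \<partial>count_space UNIV)"
    unfolding weighted_gradient_bound_def quad
    by (rule has_pmf_nn_integral[OF X])
  also have "\<dots> = (\<integral>\<^sup>+x. ennreal (p' x) * ennreal (B (discrete_gradient g (real_vec x))) \<partial>count_space UNIV)"
    by (intro nn_integral_cong)
       (simp add: p B0 w ennreal_mult'[symmetric] ennreal_mult''[symmetric] mult.assoc[symmetric])
  finally show ?thesis .
qed

section \<open>The multinomial case\<close>

lemma multinomial_nn_integral:
  assumes "nonneg_probs \<pi>" "\<And>x. 0 \<le> F x"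
  shows "(\<integral>\<^sup>+x. ennreal (multinomial_pmf n \<pi> x) * ennreal (F x) \<partial>count_space UNIV) =
    ennreal (multinomial_expect n \<pi> F)"
proof -
  have "(\<integral>\<^sup>+x. ennreal (multinomial_pmf n \<pi> x) * ennreal (F x) \<partial>count_space UNIV) =
      (\<Sum>x\<in>multinomial_support n. ennreal (multinomial_pmf n \<pi> x) * ennreal (F x))"
    by (rule nn_integral_count_space') (auto simp: in_multinomial_support multinomial_pmf_outside)
  also have "\<dots> = ennreal (multinomial_expect n \<pi> F)"
    unfolding multinomial_expect_def
    by (subst sum_ennreal[symmetric])
       (simp_all add: multinomial_pmf_nonneg assms ennreal_mult del: sum_ennreal)
  finally show ?thesis .
qed

lemma valid_probs_nonneg: "valid_probs \<pi> \<Longrightarrow> nonneg_probs \<pi>"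
  by (auto simp: valid_probs_def nonneg_probs_def cell_prob_def less_imp_le split: option.splits)

lemma multinomial_pmf_pos:
  assumes "valid_probs \<pi>" "total x \<le> n"
  shows "0 < multinomial_pmf n \<pi> x"
  using assms
  by (auto simp: multinomial_pmf_inside valid_probs_def intro!: mult_pos_pos divide_pos_pos prod_pos)

text \<open>Only finitely many vectors carry mass, so second moments are finite and integrals are
  the finite sums of \<open>multinomial_expect\<close>.\<close>

lemma
  fixes X :: "'a \<Rightarrow> nat ^ 'k"
  assumes M: "prob_space M" and \<pi>: "valid_probs \<pi>" and X: "has_pmf M X (multinomial_pmf n \<pi>)"
  shows multinomial_finite_variance: "finite_variance M (\<lambda>\<omega>. F (X \<omega>))"
    and multinomial_variance_of: "variance_of M (\<lambda>\<omega>. F (X \<omega>)) = multinomial_var n \<pi> F"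
proof -
  note nn = valid_probs_nonneg[OF \<pi>]
  have nni: "(\<integral>\<^sup>+\<omega>. ennreal (H (X \<omega>)) \<partial>M) = ennreal (multinomial_expect n \<pi> H)" if "\<And>x. 0 \<le> H x" for H
    unfolding has_pmf_nn_integral[OF X, of "\<lambda>x. ennreal (H x)"] by (rule multinomial_nn_integral[OF nn that])
  have pos: "integrable M (\<lambda>\<omega>. H (X \<omega>)) \<and> (\<integral>\<omega>. H (X \<omega>) \<partial>M) = multinomial_expect n \<pi> H"
    if "\<And>x. 0 \<le> H x" for H
    using nni[of H, OF that] that multinomial_expect_nonneg[of \<pi> H, OF nn that]
    by (subst nn_integral_eq_integrable[symmetric]) (auto intro: has_pmf_measurable[OF X])
  \<comment> \<open>The formula for nonnegative functions extends to \<open>F\<close> through its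
    positive and negative parts.\<close>
  have "(\<lambda>x. max (F x) 0 - max (- F x) 0) = F" by (auto simp: fun_eq_iff max_def)
  moreover have "(\<integral>\<omega>. max (F (X \<omega>)) 0 - max (- F (X \<omega>)) 0 \<partial>M) =
      multinomial_expect n \<pi> (\<lambda>x. max (F x) 0 - max (- F x) 0)"
    using pos[of "\<lambda>x. max (F x) 0"] pos[of "\<lambda>x. max (- F x) 0"]
    by (simp add: multinomial_expect_diff)
  ultimately have mean: "(\<integral>\<omega>. F (X \<omega>) \<partial>M) = multinomial_expect n \<pi> F"
    by (metis (mono_tags, lifting) Bochner_Integration.integral_cong)
  show fin: "finite_variance M (\<lambda>\<omega>. F (X \<omega>))"
    using nni[of "\<lambda>x. (F x)\<^sup>2"] by (intro finite_varianceI M has_pmf_measurable[OF X]) auto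
  show "variance_of M (\<lambda>\<omega>. F (X \<omega>)) = multinomial_var n \<pi> F"
    unfolding variance_of_def mean multinomial_var_centred[of n \<pi> F "multinomial_expect n \<pi> F"]
    using pos[of "\<lambda>x. (F x - multinomial_expect n \<pi> F)\<^sup>2"] by simp
qed

lemma multinomial_pmf_weight:
  assumes "valid_probs \<pi>" "1 \<le> n"
  shows "multinomial_pmf n \<pi> x * multinomial_weight n \<pi> (real_vec x) = multinomial_pmf (n - 1) \<pi> x"
proof (cases "total x \<le> n")
  case True
  have n: "n = Suc (n - 1)" using assms by simp
  have "real n - (\<Sum>i\<in>UNIV. real_vec x $ i) = real (n - total x)"
    using True by (simp add: real_vec_def of_nat_diff total_def)
  moreover have "multinomial_pmf n \<pi> x * real (n - total x) = real n * rest_prob \<pi> * multinomial_pmf (n - 1) \<pi> x"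
    using multinomial_pmf_rest[of "n - 1" \<pi> x] n by simp
  ultimately show ?thesis
    using assms by (simp add: multinomial_weight_def valid_probs_def)
next
  case False
  thus ?thesis using assms by (simp add: multinomial_pmf_outside)
qed

lemma multinomial_efron_stein_eq_iff:
  fixes f :: "nat ^ 'k \<Rightarrow> real"
  assumes \<pi>: "valid_probs \<pi>"
  shows "multinomial_var n \<pi> f = real n * multinomial_expect (n - 1) \<pi> (step_var \<pi> f) \<longleftrightarrow>
    (\<exists>a v. \<forall>x\<in>multinomial_support n. f x = affine_fun a v x)"
proof
  assume eq: "multinomial_var n \<pi> f = real n * multinomial_expect (n - 1) \<pi> (step_var \<pi> f)"
  have pos: "0 < cell_prob \<pi> j" for j
    using \<pi> by (cases j) (auto simp: valid_probs_def)
  have "f (y + axis i 1 + axis j 1) - f (y + axis i 1) = f (y + axis j 1) - f y"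
    if "total y + 2 \<le> n" for y i j
  proof -
    define m where "m = n - 2"
    have "mixed_var \<pi> f y = 0"
      using that
      by (intro multinomial_efron_stein_eqD[OF valid_probs_nonneg[OF \<pi>] eq, of m] multinomial_pmf_pos \<pi>)
         (auto simp: m_def)
    \<comment> \<open>The remaining cell has positive probability and step 0; comparing it with the
      cells \<open>i\<close> and \<open>j\<close> turns the mixed difference into the second
      difference at \<open>y\<close>.\<close>
    from mixed_var_eq_0D[OF valid_probs_nonneg[OF \<pi>] this pos pos pos pos, of "Some i" "Some j" None None]
    show ?thesis by simp
  qed
  hence "f x = affine_fun (f 0) (\<chi> i. f (axis i 1) - f 0) x" if "x \<in> multinomial_support n" for x
    using that by (intro affine_if_second_differences_vanish[of n]) (auto simp: in_multinomial_support)
  thus "\<exists>a v. \<forall>x\<in>multinomial_support n. f x = affine_fun a v x" by blast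
next
  assume "\<exists>a v. \<forall>x\<in>multinomial_support n. f x = affine_fun a v x"
  then obtain a v where f: "\<And>x. total x \<le> n \<Longrightarrow> f x = affine_fun a v x"
    by (auto simp: in_multinomial_support)
  have "multinomial_var n \<pi> f = multinomial_var n \<pi> (affine_fun a v)"
    using f by (rule multinomial_var_cong)
  moreover have "real n * multinomial_expect (n - 1) \<pi> (step_var \<pi> f) =
      real n * multinomial_expect (n - 1) \<pi> (\<lambda>_. weighted_var (cell_prob \<pi>) (slope v))"
  proof (cases n)
    case (Suc m)
    have "step_var \<pi> f y = step_var \<pi> (affine_fun a v) y" if "total y \<le> m" for y
    proof -
      have "total (y + cell_step j) \<le> n" for j
        using that Suc by (cases j) auto
      thus ?thesis by (simp add: step_var_def f)
    qed
    thus ?thesis using Suc by (simp add: step_var_affine cong: multinomial_expect_cong)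
  qed simp
  ultimately show "multinomial_var n \<pi> f = real n * multinomial_expect (n - 1) \<pi> (step_var \<pi> f)"
    by (simp only: multinomial_var_affine multinomial_expect_const)
qed

text \<open>After the change to \<open>n - 1\<close> trials the bound is a finite real number, and
  both claims become the Efron-Stein inequality with its equality case.\<close>

theorem multinomial_variance_bound:
  fixes X :: "'a \<Rightarrow> nat ^ 'k"
  assumes M: "prob_space M" and n: "1 \<le> n" and \<pi>: "valid_probs \<pi>"
    and X: "has_pmf M X (multinomial_pmf n \<pi>)"
  shows "ennreal (variance_of M (\<lambda>\<omega>. g (real_vec (X \<omega>)))) \<le>
      weighted_gradient_bound M (\<lambda>\<omega>. real_vec (X \<omega>)) (multinomial_weight n \<pi>) g"
    and "ennreal (variance_of M (\<lambda>\<omega>. g (real_vec (X \<omega>)))) =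
      weighted_gradient_bound M (\<lambda>\<omega>. real_vec (X \<omega>)) (multinomial_weight n \<pi>) g \<longleftrightarrow>
      linear_on_support g (multinomial_support n)"
proof -
  note nn = valid_probs_nonneg[OF \<pi>]
  let ?G = "\<lambda>x. g (real_vec x)"
  have "weighted_gradient_bound M (\<lambda>\<omega>. real_vec (X \<omega>)) (multinomial_weight n \<pi>) g =
      (\<integral>\<^sup>+x. ennreal (multinomial_pmf (n - 1) \<pi> x) * ennreal (real n * step_var \<pi> ?G x) \<partial>count_space UNIV)"
    unfolding step_var_discrete_gradient[symmetric]
    by (rule weighted_gradient_bound_eq[OF X])
       (simp_all add: multinomial_finite_variance[OF M \<pi> X] multinomial_variance_of[OF M \<pi> X]
         multinomial_var_affine multinomial_pmf_nonneg[OF nn] multinomial_pmf_weight[OF \<pi> n] del: One_nat_def)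
  also have "\<dots> = ennreal (real n * multinomial_expect (n - 1) \<pi> (step_var \<pi> ?G))"
    by (subst multinomial_nn_integral[OF nn]) (simp_all add: step_var_nonneg[OF nn] multinomial_expect_cmult)
  finally have bound: "weighted_gradient_bound M (\<lambda>\<omega>. real_vec (X \<omega>)) (multinomial_weight n \<pi>) g =
    ennreal (real n * multinomial_expect (n - 1) \<pi> (step_var \<pi> ?G))" .
  have var: "variance_of M (\<lambda>\<omega>. g (real_vec (X \<omega>))) = multinomial_var n \<pi> ?G"
    by (rule multinomial_variance_of[OF M \<pi> X])
  show "ennreal (variance_of M (\<lambda>\<omega>. g (real_vec (X \<omega>)))) \<le>
      weighted_gradient_bound M (\<lambda>\<omega>. real_vec (X \<omega>)) (multinomial_weight n \<pi>) g"
    unfolding bound var by (intro ennreal_leI multinomial_efron_stein nn)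
  have "0 \<le> real n * multinomial_expect (n - 1) \<pi> (step_var \<pi> ?G)"
    by (intro mult_nonneg_nonneg multinomial_expect_nonneg nn step_var_nonneg) simp
  thus "ennreal (variance_of M (\<lambda>\<omega>. g (real_vec (X \<omega>)))) =
      weighted_gradient_bound M (\<lambda>\<omega>. real_vec (X \<omega>)) (multinomial_weight n \<pi>) g \<longleftrightarrow>
      linear_on_support g (multinomial_support n)"
    unfolding bound var linear_on_support_iff multinomial_efron_stein_eq_iff[OF \<pi>, symmetric]
    using multinomial_var_nonneg[OF nn] by (simp add: ennreal_inj)
qed

section \<open>The negative multinomial case\<close>

lemma multinomial_expect_increment:
  "multinomial_expect (Suc n) q f - multinomial_expect n q f =
     multinomial_expect n q (\<lambda>x. step_mean q f x - f x)"
  by (simp add: multinomial_expect_Suc multinomial_expect_diff)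

text \<open>
  When \<open>rest_prob q = 0\<close>, the formula for \<open>multinomial_pmf n q\<close> puts all mass on vectors with total \<open>n\<close>,
  because \<open>0 ^ 0 = 1\<close>.
\<close>

context
  fixes q :: "real ^ 'k"
  assumes q: "\<And>i. 0 < q $ i" "rest_prob q = 0"
begin

lemma nonneg_probs_q: "nonneg_probs q"
  using q by (auto simp: nonneg_probs_def cell_prob_def less_imp_le split: option.splits)

lemma multinomial_pmf_total_pos: "0 < multinomial_pmf (total x) q x"
  using q(1) by (auto simp: multinomial_pmf_inside intro!: mult_pos_pos divide_pos_pos prod_pos)

lemma multinomial_pmf_not_total: "n \<noteq> total x \<Longrightarrow> multinomial_pmf n q x = 0"
  using q(2) by (cases "total x \<le> n") (auto simp: multinomial_pmf_inside multinomial_pmf_outside)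

text \<open>The three conditions are equality in Efron-Stein for each fixed total, in the bound of a
  squared mean by a mean square for \<open>step_mean q f x - f x\<close>, and in the Poincare
  inequality for the totals.\<close>

lemma affine_iff_deficits_vanish:
  fixes f :: "nat ^ 'k \<Rightarrow> real"
  shows "(\<exists>a v. f = affine_fun a v) \<longleftrightarrow>
    (\<forall>n. multinomial_var n q f = real n * multinomial_expect (n - 1) q (step_var q f)) \<and>
    (\<forall>n. multinomial_var n q (\<lambda>x. step_mean q f x - f x) = 0) \<and>
    (\<exists>d. \<forall>n. multinomial_expect n q (\<lambda>x. step_mean q f x - f x) = d)"
    (is "?L \<longleftrightarrow> ?A \<and> ?B \<and> ?C")
proof
  assume ?L
  then obtain a v where f: "f = affine_fun a v" by blast
  have "step_var q f = (\<lambda>_. weighted_var (cell_prob q) (slope v))"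
    unfolding f by (simp add: fun_eq_iff step_var_affine)
  moreover have D: "(\<lambda>x. step_mean q f x - f x) = (\<lambda>_. \<Sum>i\<in>UNIV. q $ i * v $ i)"
    unfolding f by (simp add: fun_eq_iff step_mean_affine)
  moreover have "multinomial_var n q (\<lambda>_. c) = 0" for n c
    by (simp add: multinomial_var_def)
  ultimately show "?A \<and> ?B \<and> ?C"
    unfolding D using multinomial_var_affine[of _ q a v] f by simp
next
  assume R: "?A \<and> ?B \<and> ?C"
  then obtain d where d: "multinomial_expect n q (\<lambda>x. step_mean q f x - f x) = d" for n
    by blast
  \<comment> \<open>Each \<open>x\<close> has positive mass under the law with
    \<open>total x\<close> trials, so the vanishing variance there fixes the value at
    \<open>x\<close>.\<close>
  have D: "step_mean q f x - f x = d" for x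
  proof -
    have "multinomial_var (total x) q (\<lambda>x. step_mean q f x - f x) = 0" using R by blast
    from multinomial_var_eq_0D[OF nonneg_probs_q this multinomial_pmf_total_pos] show ?thesis
      unfolding d .
  qed
  define H where "H = (\<lambda>y i j. f (y + axis i 1 + axis j 1) - f (y + axis i 1) - f (y + axis j 1) + f y)"
  have q1: "(\<Sum>i\<in>UNIV. q $ i) = 1" using q(2) by (simp add: rest_prob_def)
  have sm: "step_mean q f x = (\<Sum>i\<in>UNIV. q $ i * f (x + axis i 1))" for x
    using q(2) by (simp add: step_mean_def sum_option)
  \<comment> \<open>The remaining cell now has probability 0, so only proper cells can be compared;
    this gives cross differences of \<open>H\<close> rather than \<open>H\<close> itself.\<close>
  have cross: "H y i j - H y i l - H y k j + H y k l = 0" for y i j k l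
  proof -
    have "mixed_var q f y = 0"
      using R multinomial_efron_stein_eqD[OF nonneg_probs_q _ refl multinomial_pmf_total_pos] by blast
    from mixed_var_eq_0D[OF nonneg_probs_q this, of "Some j" "Some l" "Some i" "Some k"] q(1)
    show ?thesis by (simp add: H_def)
  qed
  have H_sym: "H y i j = H y j i" for y i j
    by (simp add: H_def add_ac)
  \<comment> \<open>The missing information on \<open>H\<close>: the weighted sum is the change of
    the constant \<open>step_mean q f x - f x\<close> from \<open>y\<close> to
    \<open>y + axis j 1\<close>.\<close>
  have mean0: "(\<Sum>i\<in>UNIV. q $ i * H y i j) = 0" for y j
  proof -
    have "(\<Sum>i\<in>UNIV. q $ i * H y i j) =
        (\<Sum>i\<in>UNIV. q $ i * f (y + axis j 1 + axis i 1)) - (\<Sum>i\<in>UNIV. q $ i * f (y + axis i 1))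
        - (\<Sum>i\<in>UNIV. q $ i) * f (y + axis j 1) + (\<Sum>i\<in>UNIV. q $ i) * f y"
      by (simp only: H_def ring_distribs sum.distrib sum_subtractf sum_distrib_right) (simp add: add_ac)
    also have "\<dots> = (step_mean q f (y + axis j 1) - f (y + axis j 1)) - (step_mean q f y - f y)"
      unfolding q1 sm by simp
    finally show ?thesis unfolding D by simp
  qed
  \<comment> \<open>average \<open>cross\<close> over \<open>k\<close>, then over \<open>l\<close>, using \<open>mean0\<close>\<close>
  have H0: "H y i j = 0" for y i j
  proof -
    have "H y i j = H y i l" for l
    proof -
      have "0 = (\<Sum>k\<in>UNIV. q $ k * (H y i j - H y i l - H y k j + H y k l))"
        by (simp add: cross)
      also have "\<dots> = (\<Sum>k\<in>UNIV. q $ k) * (H y i j - H y i l) - (\<Sum>k\<in>UNIV. q $ k * H y k j) + (\<Sum>k\<in>UNIV. q $ k * H y k l)"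
        by (simp only: ring_distribs sum.distrib sum_subtractf sum_distrib_right)
      finally show ?thesis unfolding mean0 q1 by simp
    qed
    hence "(\<Sum>l\<in>UNIV. q $ l * H y l i) = (\<Sum>l\<in>UNIV. q $ l * H y i j)"
      using H_sym by (intro sum.cong refl) metis
    also have "\<dots> = H y i j"
      unfolding sum_distrib_right[symmetric] q1 by simp
    finally show ?thesis unfolding mean0 by simp
  qed
  have "f (y + axis i 1 + axis j 1) - f (y + axis i 1) = f (y + axis j 1) - f y" for y i j
    using H0[of y i j] unfolding H_def by linarith
  hence "f x = affine_fun (f 0) (\<chi> i. f (axis i 1) - f 0) x" for x
    by (intro affine_if_second_differences_vanish[of "total x"]) blast+
  hence "f = affine_fun (f 0) (\<chi> i. f (axis i 1) - f 0)" by blast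
  thus ?L by blast
qed

section \<open>The variance bound for a mixture over the total\<close>

context
  fixes r t :: real
  assumes r: "0 < r" and t: "0 < t" "t < 1"
begin

text \<open>For affine \<open>f\<close> this is the law of total variance given the total: the
  variance of one trial times the mean \<open>r * t / (1 - t)\<close> of the total, plus the squared
  mean slope times its variance \<open>r * t / (1 - t)^2\<close>.\<close>

definition nm_gradient :: "(nat ^ 'k \<Rightarrow> real) \<Rightarrow> nat ^ 'k \<Rightarrow> real" where
  "nm_gradient f x = r * (t / (1 - t) * step_var q f x + t / (1 - t)\<^sup>2 * (step_mean q f x - f x)\<^sup>2)"

lemma nm_gradient_nonneg: "0 \<le> nm_gradient f x"
  unfolding nm_gradient_def using r t by (simp add: step_var_nonneg[OF nonneg_probs_q])

lemma nm_gradient_affine: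
  "nm_gradient (affine_fun a v) x = r * (t / (1 - t) * weighted_var (cell_prob q) (slope v) +
     t / (1 - t)\<^sup>2 * (\<Sum>i\<in>UNIV. q $ i * v $ i)\<^sup>2)"
  by (simp add: nm_gradient_def step_var_affine step_mean_affine)

text \<open>Separates the part within a fixed total from the part between totals; the coefficient of
  the latter is the kernel of the Poincare inequality.\<close>

lemma nm_gradient_expect:
  "neg_binomial (r + 1) t n * multinomial_expect n q (nm_gradient f) =
     r * t / (1 - t) * neg_binomial (r + 1) t n * multinomial_expect n q (step_var q f) +
     nb_kernel r t n * multinomial_expect n q (\<lambda>x. (step_mean q f x - f x)\<^sup>2)"
proof -
  have "nm_gradient f = (\<lambda>x. (r * (t / (1 - t))) * step_var q f x + (r * (t / (1 - t)\<^sup>2)) * (step_mean q f x - f x)\<^sup>2)"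
    by (simp add: fun_eq_iff nm_gradient_def distrib_left)
  hence "multinomial_expect n q (nm_gradient f) = (r * (t / (1 - t))) * multinomial_expect n q (step_var q f) +
      (r * (t / (1 - t)\<^sup>2)) * multinomial_expect n q (\<lambda>x. (step_mean q f x - f x)\<^sup>2)"
    by (simp only: multinomial_expect_add multinomial_expect_cmult)
  thus ?thesis by (simp add: nb_kernel_def[OF r t] algebra_simps)
qed

text \<open>The variance splits into \<open>a1\<close> (within totals) and \<open>b1\<close> (of the
  conditional mean \<open>h\<close>). Efron-Stein bounds \<open>a1\<close> by \<open>a2\<close>,
  Poincare bounds \<open>b1\<close> by \<open>b2\<close> in sum, and \<open>b2\<close> is at most
  \<open>b3\<close> since a squared mean is at most the mean square; \<open>a2\<close> and
  \<open>b3\<close> make up the right-hand side.\<close>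

theorem neg_multinomial_poincare:
  fixes f :: "nat ^ 'k \<Rightarrow> real"
  assumes c: "(\<lambda>n. neg_binomial r t n * multinomial_expect n q f) sums c"
    and v: "(\<lambda>n. neg_binomial r t n * multinomial_expect n q (\<lambda>x. (f x - c)\<^sup>2)) sums v"
  shows "ennreal v \<le> (\<integral>\<^sup>+n. ennreal (neg_binomial (r + 1) t n * multinomial_expect n q (nm_gradient f)) \<partial>count_space UNIV)"
      (is "_ \<le> ?R")
    and "ennreal v = (\<integral>\<^sup>+n. ennreal (neg_binomial (r + 1) t n * multinomial_expect n q (nm_gradient f)) \<partial>count_space UNIV)
      \<longleftrightarrow> (\<exists>a v. f = affine_fun a v)"
proof -
  let ?p = "neg_binomial r t" and ?E = "\<lambda>n. multinomial_expect n q"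
  have p: "0 < ?p n" for n by (rule neg_binomial_pos[OF r t])
  have p': "0 < neg_binomial (r + 1) t n" for n using r t by (intro neg_binomial_pos) auto
  note \<kappa> = nb_kernel_pos[OF r t]
  define h where "h = (\<lambda>n. ?E n f)"
  define D where "D = (\<lambda>x. step_mean q f x - f x)"
  define a1 where "a1 = (\<lambda>n. ?p n * multinomial_var n q f)"
  define b1 where "b1 = (\<lambda>n. ?p n * (h n - c)\<^sup>2)"
  define a2 where "a2 = (\<lambda>n. ?p n * (real n * ?E (n - 1) (step_var q f)))"
  define b2 where "b2 = (\<lambda>n. nb_kernel r t n * (h (Suc n) - h n)\<^sup>2)"
  define b3 where "b3 = (\<lambda>n. nb_kernel r t n * ?E n (\<lambda>x. (D x)\<^sup>2))"
  let ?I = "\<lambda>a. \<integral>\<^sup>+n. ennreal (a n) \<partial>count_space UNIV"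
  have nn: "0 \<le> a1 n" "0 \<le> b1 n" "0 \<le> a2 n" "0 \<le> b2 n" "0 \<le> b3 n" for n
    unfolding a1_def b1_def a2_def b2_def b3_def
    using p[of n] \<kappa>[of n] multinomial_var_nonneg[OF nonneg_probs_q]
    by (auto intro!: mult_nonneg_nonneg multinomial_expect_nonneg nonneg_probs_q step_var_nonneg)
  have split: "?p n * ?E n (\<lambda>x. (f x - c)\<^sup>2) = a1 n + b1 n" for n
    unfolding a1_def b1_def h_def multinomial_var_centred[of n q f c] by (simp add: algebra_simps)
  have ab: "(\<lambda>n. a1 n + b1 n) sums v" using v unfolding split .
  \<comment> \<open>\<open>b1\<close> is dominated by the summable \<open>a1 + b1\<close>; its sum
    \<open>v1\<close> is the variance of \<open>h\<close> required by the Poincare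
    inequality.\<close>
  have "summable b1"
    using nn by (intro summable_comparison_test'[OF sums_summable[OF ab]]) simp
  then obtain v1 where v1: "b1 sums v1" unfolding summable_def by blast
  have V: "ennreal v = ?I a1 + ?I b1"
  proof -
    have "?I a1 + ?I b1 = (\<integral>\<^sup>+n. ennreal (a1 n) + ennreal (b1 n) \<partial>count_space UNIV)"
      by (rule nn_integral_add[symmetric]) auto
    also have "\<dots> = ?I (\<lambda>n. a1 n + b1 n)"
      using nn by (intro nn_integral_cong) (simp add: ennreal_plus)
    also have "\<dots> = ennreal v" using nn by (intro nn_integral_sums ab) (simp add: add_nonneg_nonneg)
    finally show ?thesis ..
  qed
  have fin: "?I a1 + ?I b1 \<noteq> \<infinity>" unfolding V[symmetric] by simp
  hence fin1: "?I a1 \<noteq> \<infinity>" "?I b1 \<noteq> \<infinity>" by (auto simp: top_unique)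
  have R: "?R = ?I a2 + ?I b3"
  proof -
    \<comment> \<open>As \<open>a2 0 = 0\<close>, the index can be shifted; size biasing then
      replaces \<open>r\<close> by \<open>r + 1\<close>, matching the reweighted law.\<close>
    have "?I a2 = (\<integral>\<^sup>+n. ennreal (a2 (Suc n)) \<partial>count_space UNIV)"
      by (rule nn_integral_count_space_shift) (simp add: a2_def)
    moreover have "a2 (Suc n) = r * t / (1 - t) * neg_binomial (r + 1) t n * ?E n (step_var q f)" for n
      unfolding a2_def neg_binomial_Suc[OF r t, symmetric] by simp
    hence "neg_binomial (r + 1) t n * multinomial_expect n q (nm_gradient f) = a2 (Suc n) + b3 n" for n
      unfolding nm_gradient_expect b3_def D_def by simp
    hence "?R = (\<integral>\<^sup>+n. ennreal (a2 (Suc n)) + ennreal (b3 n) \<partial>count_space UNIV)"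
      using nn by (intro nn_integral_cong) (simp add: ennreal_plus)
    moreover have "\<dots> = (\<integral>\<^sup>+n. ennreal (a2 (Suc n)) \<partial>count_space UNIV) + ?I b3"
      by (rule nn_integral_add) auto
    ultimately show ?thesis by simp
  qed
  have a12: "a1 n \<le> a2 n" for n
    unfolding a1_def a2_def using p[of n]
    by (intro mult_left_mono multinomial_efron_stein nonneg_probs_q) simp
  have incr: "h (Suc n) - h n = ?E n D" for n
    unfolding h_def D_def by (rule multinomial_expect_increment)
  have b32: "b3 n - b2 n = nb_kernel r t n * multinomial_var n q D" for n
    unfolding b2_def b3_def incr by (simp add: multinomial_var_def algebra_simps)
  have b23: "b2 n \<le> b3 n" for n
  proof -
    have "0 \<le> b3 n - b2 n"
      unfolding b32 using \<kappa>[of n] multinomial_var_nonneg[OF nonneg_probs_q, of n D] by simp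
    thus ?thesis by simp
  qed
  have A12: "?I a1 \<le> ?I a2" using nn(1) a12 by (rule nn_integral_count_space_compare)
  have B23: "?I b2 \<le> ?I b3" using nn(4) b23 by (rule nn_integral_count_space_compare)
  have Ib1: "?I b1 = ennreal v1" using nn(2) v1 by (rule nn_integral_sums)
  have hc: "(\<lambda>n. ?p n * h n) sums c" using c unfolding h_def .
  note poincare = neg_binomial_poincare[OF r t hc v1[unfolded b1_def]]
  have B12: "?I b1 \<le> ?I b2"
    using poincare(1) unfolding Ib1 b2_def .
  have B12_eq: "?I b1 = ?I b2 \<longleftrightarrow> (\<exists>d. \<forall>n. ?E n D = d)"
    using poincare(2) unfolding Ib1 b2_def incr .
  show "ennreal v \<le> ?R"
    unfolding V R using A12 B12 B23 by (intro add_mono) auto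
  \<comment> \<open>The finite variance allows equality of the sums to be split into equality in
    each of the three estimates, which are then treated one by one.\<close>
  have "ennreal v = ?R \<longleftrightarrow> ?I a1 = ?I a2 \<and> ?I b2 = ?I b3 \<and> ?I b1 = ?I b2"
  proof
    assume "ennreal v = ?R"
    hence eq: "?I a1 + ?I b1 = ?I a2 + ?I b3" unfolding V R .
    hence "?I a1 = ?I a2 \<and> ?I b1 = ?I b3"
      using A12 B12 B23 fin by (intro ennreal_add_eq_addD) auto
    with B12 B23 show "?I a1 = ?I a2 \<and> ?I b2 = ?I b3 \<and> ?I b1 = ?I b2" by auto
  next
    assume "?I a1 = ?I a2 \<and> ?I b2 = ?I b3 \<and> ?I b1 = ?I b2"
    thus "ennreal v = ?R" unfolding V R by simp
  qed
  also have "?I a1 = ?I a2 \<longleftrightarrow> (\<forall>n. a1 n = a2 n)"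
    using nn_integral_count_space_eqD[of a1 a2, OF nn(1) a12 _ fin1(1)] by auto
  also have "(?I b2 = ?I b3 \<and> ?I b1 = ?I b2) \<longleftrightarrow> ((\<forall>n. b2 n = b3 n) \<and> ?I b1 = ?I b2)"
  proof -
    have "\<forall>n. b2 n = b3 n" if "?I b2 = ?I b3" "?I b1 = ?I b2"
      using nn_integral_count_space_eqD[of b2 b3, OF nn(4) b23 that(1)] fin1(2) that(2) by simp
    moreover have "?I b2 = ?I b3" if "\<forall>n. b2 n = b3 n" using that by simp
    ultimately show ?thesis by blast
  qed
  also have "(\<forall>n. a1 n = a2 n) \<longleftrightarrow> (\<forall>n. multinomial_var n q f = real n * ?E (n - 1) (step_var q f))"
    unfolding a1_def a2_def using p by (simp add: less_imp_neq[symmetric])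
  also have "(\<forall>n. b2 n = b3 n) \<longleftrightarrow> (\<forall>n. multinomial_var n q D = 0)"
  proof -
    have "b2 n = b3 n \<longleftrightarrow> nb_kernel r t n * multinomial_var n q D = 0" for n
      unfolding b32[symmetric] by auto
    thus ?thesis using \<kappa> by (simp add: less_imp_neq[symmetric])
  qed
  also note B12_eq
  also have "((\<forall>n. multinomial_var n q f = real n * ?E (n - 1) (step_var q f)) \<and>
      (\<forall>n. multinomial_var n q D = 0) \<and> (\<exists>d. \<forall>n. ?E n D = d)) \<longleftrightarrow> (\<exists>a v. f = affine_fun a v)"
    unfolding D_def affine_iff_deficits_vanish ..
  finally show "ennreal v = ?R \<longleftrightarrow> (\<exists>a v. f = affine_fun a v)" .
qed

end

end

section \<open>The negative multinomial law as a mixture over its total\<close>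

definition success_prob :: "real ^ 'k \<Rightarrow> real" where
  "success_prob \<theta> = (\<Sum>i\<in>UNIV. \<theta> $ i)"

definition conditional_probs :: "real ^ 'k \<Rightarrow> real ^ 'k" where
  "conditional_probs \<theta> = (\<chi> i. \<theta> $ i / success_prob \<theta>)"

lemma
  fixes \<theta> :: "real ^ 'k"
  assumes "valid_probs \<theta>"
  shows success_prob_pos: "0 < success_prob \<theta>"
    and success_prob_less_1: "success_prob \<theta> < 1"
    and conditional_probs_pos: "0 < conditional_probs \<theta> $ i"
    and rest_prob_conditional_probs: "rest_prob (conditional_probs \<theta>) = 0"
proof -
  show pos: "0 < success_prob \<theta>"
    unfolding success_prob_def using assms by (intro sum_pos) (auto simp: valid_probs_def)
  show "success_prob \<theta> < 1"
    using assms by (simp add: valid_probs_def rest_prob_def success_prob_def)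
  show "0 < conditional_probs \<theta> $ i"
    using assms pos by (simp add: conditional_probs_def valid_probs_def)
  have "(\<Sum>i\<in>UNIV. \<theta> $ i / success_prob \<theta>) = 1"
    using pos by (simp add: sum_divide_distrib[symmetric] success_prob_def[symmetric])
  thus "rest_prob (conditional_probs \<theta>) = 0"
    by (simp add: rest_prob_def conditional_probs_def)
qed

lemma rest_prob_eq: "rest_prob \<theta> = 1 - success_prob \<theta>"
  by (simp add: rest_prob_def success_prob_def)

text \<open>The powers of \<open>success_prob \<theta>\<close> collect into a power of the total,
  the factorial of the total cancels between the two factors, and the remaining cell contributes
  \<open>0 ^ 0 = 1\<close>.\<close>

lemma neg_multinomial_pmf_eq:
  assumes r: "0 < r" and \<theta>: "valid_probs \<theta>"
  shows "neg_multinomial_pmf r \<theta> x = neg_binomial r (success_prob \<theta>) (total x) *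
    multinomial_pmf (total x) (conditional_probs \<theta>) x"
proof -
  let ?t = "success_prob \<theta>"
  have t: "0 < ?t" using \<theta> by (rule success_prob_pos)
  have "\<theta> $ i ^ (x $ i) = ?t ^ (x $ i) * conditional_probs \<theta> $ i ^ (x $ i)" for i
    using t by (simp add: conditional_probs_def power_divide)
  hence "(\<Prod>i\<in>UNIV. \<theta> $ i ^ (x $ i)) = ?t ^ total x * (\<Prod>i\<in>UNIV. conditional_probs \<theta> $ i ^ (x $ i))"
    by (simp add: prod.distrib power_sum total_def)
  moreover have "r \<notin> \<int>\<^sub>\<le>\<^sub>0" using r by (auto elim!: nonpos_Ints_cases)
  hence "Gamma (r + real (total x)) / Gamma r = pochhammer r (total x)"
    by (simp add: pochhammer_Gamma)
  hence "Gamma (r + real (total x)) / ((\<Prod>i\<in>UNIV. fact (x $ i)) * Gamma r) =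
      pochhammer r (total x) / (\<Prod>i\<in>UNIV. fact (x $ i))"
    by (metis divide_divide_eq_left' mult.commute)
  ultimately show ?thesis
    unfolding neg_multinomial_pmf_def total_def[symmetric] neg_binomial_def rest_prob_eq
    by (simp add: multinomial_pmf_inside)
qed

text \<open>After exchanging the sums, only \<open>n = total x\<close> contributes for a given
  \<open>x\<close>.\<close>

lemma neg_multinomial_nn_integral:
  fixes F :: "nat ^ 'k \<Rightarrow> real"
  assumes r: "0 < r" and \<theta>: "valid_probs \<theta>" and F: "\<And>x. 0 \<le> F x"
  shows "(\<integral>\<^sup>+x. ennreal (neg_multinomial_pmf r \<theta> x) * ennreal (F x) \<partial>count_space UNIV) =
    (\<integral>\<^sup>+n. ennreal (neg_binomial r (success_prob \<theta>) n * multinomial_expect n (conditional_probs \<theta>) F) \<partial>count_space UNIV)"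
proof -
  let ?p = "neg_binomial r (success_prob \<theta>)" and ?q = "conditional_probs \<theta>"
  note q = conditional_probs_pos[OF \<theta>] rest_prob_conditional_probs[OF \<theta>]
  have nn: "nonneg_probs ?q" using q by (rule nonneg_probs_q)
  have p: "0 \<le> ?p n" for n
    by (intro less_imp_le neg_binomial_pos r success_prob_pos success_prob_less_1 \<theta>)
  have "(\<integral>\<^sup>+n. ennreal (?p n * multinomial_expect n ?q F) \<partial>count_space UNIV) =
      (\<integral>\<^sup>+n. \<integral>\<^sup>+x. ennreal (?p n) * (ennreal (multinomial_pmf n ?q x) * ennreal (F x)) \<partial>count_space UNIV \<partial>count_space UNIV)"
    by (intro nn_integral_cong)
       (simp add: nn_integral_cmult multinomial_nn_integral[OF nn F] ennreal_mult p multinomial_expect_nonneg[OF nn F])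
  also have "\<dots> = (\<integral>\<^sup>+x. \<integral>\<^sup>+n. ennreal (?p n) * (ennreal (multinomial_pmf n ?q x) * ennreal (F x)) \<partial>count_space UNIV \<partial>count_space UNIV)"
    by (rule nn_integral_count_space_swap)
  also have "\<dots> = (\<integral>\<^sup>+x. ennreal (neg_multinomial_pmf r \<theta> x) * ennreal (F x) \<partial>count_space UNIV)"
  proof (rule nn_integral_cong)
    fix x :: "nat ^ 'k"
    have "(\<integral>\<^sup>+n. ennreal (?p n) * (ennreal (multinomial_pmf n ?q x) * ennreal (F x)) \<partial>count_space UNIV) =
        (\<Sum>n\<in>{total x}. ennreal (?p n) * (ennreal (multinomial_pmf n ?q x) * ennreal (F x)))"
      by (rule nn_integral_count_space') (auto simp: multinomial_pmf_not_total[OF q])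
    thus "(\<integral>\<^sup>+n. ennreal (?p n) * (ennreal (multinomial_pmf n ?q x) * ennreal (F x)) \<partial>count_space UNIV) =
        ennreal (neg_multinomial_pmf r \<theta> x) * ennreal (F x)"
      by (simp add: neg_multinomial_pmf_eq[OF r \<theta>] ennreal_mult p multinomial_pmf_nonneg[OF nn] mult.assoc)
  qed
  finally show ?thesis ..
qed

lemma neg_multinomial_pmf_weight:
  assumes r: "0 < r" and \<theta>: "valid_probs \<theta>"
  shows "neg_multinomial_pmf r \<theta> x * neg_multinomial_weight r \<theta> (real_vec x) = neg_multinomial_pmf (r + 1) \<theta> x"
proof -
  have w: "neg_multinomial_weight r \<theta> (real_vec x) = (1 - success_prob \<theta>) * (r + real (total x)) / r"
    by (simp add: neg_multinomial_weight_def rest_prob_eq total_def real_vec_def)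
  have "0 < r + 1" using r by simp
  thus ?thesis
    unfolding neg_multinomial_pmf_eq[OF r \<theta>] neg_multinomial_pmf_eq[OF \<open>0 < r + 1\<close> \<theta>] w
    by (simp add: neg_binomial_weight[OF r success_prob_pos[OF \<theta>] success_prob_less_1[OF \<theta>], symmetric])
qed

lemma multinomial_expect_affine:
  "multinomial_expect n \<pi> (affine_fun a v) = a + real n * (\<Sum>i\<in>UNIV. \<pi> $ i * v $ i)"
proof (induction n)
  case 0
  show ?case by (simp add: affine_fun_def)
next
  case (Suc n)
  have "step_mean \<pi> (affine_fun a v) = (\<lambda>y. affine_fun a v y + (\<Sum>i\<in>UNIV. \<pi> $ i * v $ i))"
    by (simp add: fun_eq_iff step_mean_affine)
  thus ?case by (simp add: multinomial_expect_Suc multinomial_expect_add Suc algebra_simps)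
qed

text \<open>Size biasing absorbs one factor \<open>Suc n\<close>, which leaves the mean and the
  total mass for the parameter \<open>r + 1\<close>.\<close>

lemma neg_binomial_second_moment:
  assumes r: "0 < r" and t: "0 < t" "t < 1"
  shows "summable (\<lambda>n. (real n)\<^sup>2 * neg_binomial r t n)"
proof -
  have r1: "0 < r + 1" using r by simp
  have "summable (\<lambda>n. r * t / (1 - t) * (real n * neg_binomial (r + 1) t n + neg_binomial (r + 1) t n))"
    using neg_binomial_mean[OF r1 t] neg_binomial_sums[OF r1 t]
    by (intro summable_mult summable_add) (auto simp: sums_iff)
  moreover have "r * t / (1 - t) * (real n * neg_binomial (r + 1) t n + neg_binomial (r + 1) t n) =
      (real (Suc n))\<^sup>2 * neg_binomial r t (Suc n)" for n
  proof -
    have "r * t / (1 - t) * (real n * neg_binomial (r + 1) t n + neg_binomial (r + 1) t n) =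
        real (Suc n) * (r * t / (1 - t) * neg_binomial (r + 1) t n)"
      by (simp add: algebra_simps add_divide_distrib)
    thus ?thesis unfolding neg_binomial_Suc[OF r t, symmetric]
      by (simp only: power2_eq_square mult.assoc)
  qed
  ultimately have "summable (\<lambda>n. (real (Suc n))\<^sup>2 * neg_binomial r t (Suc n))" by (simp only:)
  thus ?thesis by (subst (asm) summable_Suc_iff)
qed

section \<open>Transfer to negative multinomial random vectors\<close>

context
  fixes M :: "'a measure" and X :: "'a \<Rightarrow> nat ^ 'k" and r :: real and \<theta> :: "real ^ 'k"
  assumes M: "prob_space M" and r: "0 < r" and \<theta>: "valid_probs \<theta>"
    and X: "has_pmf M X (neg_multinomial_pmf r \<theta>)"
begin

lemmas success_prob_bounds = success_prob_pos[OF \<theta>] success_prob_less_1[OF \<theta>]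
lemmas conditional_probs_props = conditional_probs_pos[OF \<theta>] rest_prob_conditional_probs[OF \<theta>]
lemmas nonneg_conditional_probs = nonneg_probs_q[OF conditional_probs_props]

lemma neg_multinomial_nn_expectation:
  assumes "\<And>x. 0 \<le> F x"
  shows "(\<integral>\<^sup>+\<omega>. ennreal (F (X \<omega>)) \<partial>M) =
    (\<integral>\<^sup>+n. ennreal (neg_binomial r (success_prob \<theta>) n * multinomial_expect n (conditional_probs \<theta>) F) \<partial>count_space UNIV)"
  unfolding has_pmf_nn_integral[OF X, of "\<lambda>x. ennreal (F x)"]
  by (rule neg_multinomial_nn_integral[OF r \<theta> assms])

lemma neg_multinomial_nonneg_expectation_sums:
  assumes F: "\<And>x. 0 \<le> F x" and int: "integrable M (\<lambda>\<omega>. F (X \<omega>))"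
  shows "(\<lambda>n. neg_binomial r (success_prob \<theta>) n * multinomial_expect n (conditional_probs \<theta>) F)
    sums (\<integral>\<omega>. F (X \<omega>) \<partial>M)"
proof (rule sums_nn_integral)
  show "0 \<le> neg_binomial r (success_prob \<theta>) n * multinomial_expect n (conditional_probs \<theta>) F" for n
    by (intro mult_nonneg_nonneg less_imp_le[OF neg_binomial_pos[OF r success_prob_bounds]] multinomial_expect_nonneg nonneg_conditional_probs F)
  show "0 \<le> (\<integral>\<omega>. F (X \<omega>) \<partial>M)" using F by simp
  show "(\<integral>\<^sup>+n. ennreal (neg_binomial r (success_prob \<theta>) n * multinomial_expect n (conditional_probs \<theta>) F)
      \<partial>count_space UNIV) = ennreal (\<integral>\<omega>. F (X \<omega>) \<partial>M)"
    using neg_multinomial_nn_expectation[of F, OF F] int F by (simp add: nn_integral_eq_integral)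
qed

lemma neg_multinomial_expectation_sums:
  assumes int: "integrable M (\<lambda>\<omega>. F (X \<omega>))"
  shows "(\<lambda>n. neg_binomial r (success_prob \<theta>) n * multinomial_expect n (conditional_probs \<theta>) F)
    sums (\<integral>\<omega>. F (X \<omega>) \<partial>M)"
proof -
  let ?P = "\<lambda>x. max (F x) 0" and ?N = "\<lambda>x. max (- F x) 0"
  have PN: "F x = ?P x - ?N x" for x by (simp add: max_def)
  have "integrable M (\<lambda>\<omega>. ?P (X \<omega>))" "integrable M (\<lambda>\<omega>. ?N (X \<omega>))"
    using int by simp_all
  note this[THEN neg_multinomial_nonneg_expectation_sums[rotated]]
  from sums_diff[OF this]
  have "(\<lambda>n. neg_binomial r (success_prob \<theta>) n * multinomial_expect n (conditional_probs \<theta>) (\<lambda>x. ?P x - ?N x))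
    sums ((\<integral>\<omega>. ?P (X \<omega>) \<partial>M) - (\<integral>\<omega>. ?N (X \<omega>) \<partial>M))"
    by (simp add: multinomial_expect_diff right_diff_distrib)
  also have "(\<integral>\<omega>. ?P (X \<omega>) \<partial>M) - (\<integral>\<omega>. ?N (X \<omega>) \<partial>M) = (\<integral>\<omega>. ?P (X \<omega>) - ?N (X \<omega>) \<partial>M)"
    using int by (intro Bochner_Integration.integral_diff[symmetric]) simp_all
  finally show ?thesis unfolding PN[symmetric] .
qed

lemma neg_multinomial_variance_poincare:
  assumes fin: "finite_variance M (\<lambda>\<omega>. F (X \<omega>))"
  defines "R \<equiv> (\<integral>\<^sup>+x. ennreal (neg_multinomial_pmf (r + 1) \<theta> x) *
    ennreal (nm_gradient (conditional_probs \<theta>) r (success_prob \<theta>) F x) \<partial>count_space UNIV)"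
  shows "ennreal (variance_of M (\<lambda>\<omega>. F (X \<omega>))) \<le> R"
    and "ennreal (variance_of M (\<lambda>\<omega>. F (X \<omega>))) = R \<longleftrightarrow> (\<exists>a v. F = affine_fun a v)"
proof -
  define c where "c = (\<integral>\<omega>. F (X \<omega>) \<partial>M)"
  have "0 < r + 1" using r by simp
  hence R: "R = (\<integral>\<^sup>+n. ennreal (neg_binomial (r + 1) (success_prob \<theta>) n *
      multinomial_expect n (conditional_probs \<theta>) (nm_gradient (conditional_probs \<theta>) r (success_prob \<theta>) F)) \<partial>count_space UNIV)"
    unfolding R_def by (rule neg_multinomial_nn_integral[OF _ \<theta> nm_gradient_nonneg[OF conditional_probs_props r success_prob_bounds]])
  have c: "(\<lambda>n. neg_binomial r (success_prob \<theta>) n * multinomial_expect n (conditional_probs \<theta>) F) sums c"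
    using fin unfolding c_def finite_variance_def by (intro neg_multinomial_expectation_sums) simp
  have v: "(\<lambda>n. neg_binomial r (success_prob \<theta>) n * multinomial_expect n (conditional_probs \<theta>) (\<lambda>x. (F x - c)\<^sup>2))
      sums variance_of M (\<lambda>\<omega>. F (X \<omega>))"
    using fin unfolding variance_of_def finite_variance_def c_def
    by (intro neg_multinomial_expectation_sums[where F="\<lambda>x. (F x - (\<integral>\<omega>. F (X \<omega>) \<partial>M))\<^sup>2"]) simp
  show "ennreal (variance_of M (\<lambda>\<omega>. F (X \<omega>))) \<le> R"
    unfolding R by (rule neg_multinomial_poincare(1)[OF conditional_probs_props r success_prob_bounds c v])
  show "ennreal (variance_of M (\<lambda>\<omega>. F (X \<omega>))) = R \<longleftrightarrow> (\<exists>a v. F = affine_fun a v)"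
    unfolding R by (rule neg_multinomial_poincare(2)[OF conditional_probs_props r success_prob_bounds c v])
qed

text \<open>Given the total \<open>n\<close>, the second moment of an affine function is a quadratic
  polynomial in \<open>n\<close>, so finiteness reduces to the second moment of the negative
  binomial.\<close>

lemma neg_multinomial_affine_finite_variance: "finite_variance M (\<lambda>\<omega>. affine_fun a v (X \<omega>))"
proof (rule finite_varianceI[OF M has_pmf_measurable[OF X]])
  let ?p = "neg_binomial r (success_prob \<theta>)" and ?q = "conditional_probs \<theta>"
  define W where "W = weighted_var (cell_prob ?q) (slope v)"
  define d where "d = (\<Sum>i\<in>UNIV. ?q $ i * v $ i)"
  have E: "multinomial_expect n ?q (\<lambda>x. (affine_fun a v x)\<^sup>2) = real n * W + (a + real n * d)\<^sup>2" for n
    using multinomial_var_affine[of n ?q a v] multinomial_expect_affine[of n ?q a v]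
    by (simp add: multinomial_var_def W_def d_def)
  have "summable (\<lambda>n. a\<^sup>2 * ?p n + (W + 2 * a * d) * (real n * ?p n) + d\<^sup>2 * ((real n)\<^sup>2 * ?p n))"
    using neg_binomial_sums[OF r success_prob_bounds] neg_binomial_mean[OF r success_prob_bounds] neg_binomial_second_moment[OF r success_prob_bounds]
    by (intro summable_add summable_mult) (auto simp: sums_iff)
  moreover have "a\<^sup>2 * ?p n + (W + 2 * a * d) * (real n * ?p n) + d\<^sup>2 * ((real n)\<^sup>2 * ?p n) =
      ?p n * multinomial_expect n ?q (\<lambda>x. (affine_fun a v x)\<^sup>2)" for n
    unfolding E by (simp add: power2_eq_square algebra_simps)
  ultimately obtain s where s: "(\<lambda>n. ?p n * multinomial_expect n ?q (\<lambda>x. (affine_fun a v x)\<^sup>2)) sums s"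
    by (auto simp: summable_def)
  have "0 \<le> ?p n * multinomial_expect n ?q (\<lambda>x. (affine_fun a v x)\<^sup>2)" for n
    by (intro mult_nonneg_nonneg less_imp_le[OF neg_binomial_pos[OF r success_prob_bounds]] multinomial_expect_nonneg nonneg_conditional_probs) simp
  from nn_integral_sums[OF this s] neg_multinomial_nn_expectation[of "\<lambda>x. (affine_fun a v x)\<^sup>2"]
  show "(\<integral>\<^sup>+\<omega>. ennreal ((affine_fun a v (X \<omega>))\<^sup>2) \<partial>M) < \<infinity>" by simp
qed

text \<open>The variance is read off from the equality case: an affine function attains the bound,
  its \<open>nm_gradient\<close> is the same at every point, and the law with \<open>r + 1\<close>
  has mass 1. The base point 0 is an arbitrary choice.\<close>

lemma neg_multinomial_affine_variance:
  "variance_of M (\<lambda>\<omega>. affine_fun a v (X \<omega>)) =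
     nm_gradient (conditional_probs \<theta>) r (success_prob \<theta>) (affine_fun 0 v) 0"
proof -
  let ?B = "nm_gradient (conditional_probs \<theta>) r (success_prob \<theta>) (affine_fun 0 v) 0"
  have r1: "0 < r + 1" using r by simp
  have B0: "0 \<le> ?B" by (rule nm_gradient_nonneg[OF conditional_probs_props r success_prob_bounds])
  have "nm_gradient (conditional_probs \<theta>) r (success_prob \<theta>) (affine_fun a v) x = ?B" for x
    by (simp add: nm_gradient_affine[OF conditional_probs_props r success_prob_bounds])
  hence "ennreal (variance_of M (\<lambda>\<omega>. affine_fun a v (X \<omega>))) =
      (\<integral>\<^sup>+x. ennreal (neg_multinomial_pmf (r + 1) \<theta> x) * ennreal ?B \<partial>count_space UNIV)"
    using neg_multinomial_variance_poincare(2)[OF neg_multinomial_affine_finite_variance, of a v] by auto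
  also have "\<dots> = (\<integral>\<^sup>+n. ennreal (neg_binomial (r + 1) (success_prob \<theta>) n * ?B) \<partial>count_space UNIV)"
    using neg_multinomial_nn_integral[OF r1 \<theta>, of "\<lambda>_. ?B"] B0 by simp
  also have "\<dots> = ennreal ?B"
    using nn_integral_sums[OF _ sums_mult2[OF neg_binomial_sums[OF r1 success_prob_bounds], of ?B]] B0
      less_imp_le[OF neg_binomial_pos[OF r1 success_prob_bounds]] by simp
  finally show ?thesis
    using ennreal_inj[OF variance_of_nonneg B0] by blast
qed

theorem neg_multinomial_variance_bound:
  assumes fin: "finite_variance M (\<lambda>\<omega>. g (real_vec (X \<omega>)))"
  shows "ennreal (variance_of M (\<lambda>\<omega>. g (real_vec (X \<omega>)))) \<le>
      weighted_gradient_bound M (\<lambda>\<omega>. real_vec (X \<omega>)) (neg_multinomial_weight r \<theta>) g"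
    and "ennreal (variance_of M (\<lambda>\<omega>. g (real_vec (X \<omega>)))) =
      weighted_gradient_bound M (\<lambda>\<omega>. real_vec (X \<omega>)) (neg_multinomial_weight r \<theta>) g \<longleftrightarrow>
      linear_on_support g neg_multinomial_support"
proof -
  let ?t = "success_prob \<theta>" and ?q = "conditional_probs \<theta>"
  let ?G = "\<lambda>x. g (real_vec x)"
  \<comment> \<open>The linear function with the gradient of \<open>g\<close> at \<open>x\<close> as
    slopes has the same one-step increments as \<open>g\<close> at \<open>x\<close>, and
    \<open>nm_gradient\<close> depends only on these.\<close>
  have grad: "nm_gradient ?q r ?t (affine_fun 0 (discrete_gradient g (real_vec x))) 0 = nm_gradient ?q r ?t ?G x" for x
  proof -
    have "(\<Sum>i\<in>UNIV. ?q $ i * discrete_gradient g (real_vec x) $ i) =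
        (\<Sum>j\<in>UNIV. cell_prob ?q j * slope (discrete_gradient g (real_vec x)) j)"
      by (simp add: sum_option)
    thus ?thesis
      unfolding nm_gradient_affine[OF conditional_probs_props r success_prob_bounds] step_var_discrete_gradient step_mean_discrete_gradient
      by (simp add: nm_gradient_def[OF conditional_probs_props r success_prob_bounds])
  qed
  have p: "0 \<le> neg_multinomial_pmf r \<theta> x" for x
    unfolding neg_multinomial_pmf_eq[OF r \<theta>]
    by (intro mult_nonneg_nonneg less_imp_le[OF neg_binomial_pos[OF r success_prob_bounds]] multinomial_pmf_nonneg nonneg_conditional_probs)
  have bound: "weighted_gradient_bound M (\<lambda>\<omega>. real_vec (X \<omega>)) (neg_multinomial_weight r \<theta>) g =
      (\<integral>\<^sup>+x. ennreal (neg_multinomial_pmf (r + 1) \<theta> x) * ennreal (nm_gradient ?q r ?t ?G x) \<partial>count_space UNIV)"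
    unfolding grad[symmetric]
    by (rule weighted_gradient_bound_eq[OF X neg_multinomial_affine_finite_variance
          neg_multinomial_affine_variance p neg_multinomial_pmf_weight[OF r \<theta>]])
  show "ennreal (variance_of M (\<lambda>\<omega>. g (real_vec (X \<omega>)))) \<le>
      weighted_gradient_bound M (\<lambda>\<omega>. real_vec (X \<omega>)) (neg_multinomial_weight r \<theta>) g"
    unfolding bound by (rule neg_multinomial_variance_poincare(1)[OF fin])
  show "ennreal (variance_of M (\<lambda>\<omega>. g (real_vec (X \<omega>)))) =
      weighted_gradient_bound M (\<lambda>\<omega>. real_vec (X \<omega>)) (neg_multinomial_weight r \<theta>) g \<longleftrightarrow>
      linear_on_support g neg_multinomial_support"
    unfolding bound linear_on_support_iff neg_multinomial_variance_poincare(2)[OF fin]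
    by (simp add: neg_multinomial_support_def fun_eq_iff)
qed

end

theorem theorem5:
  fixes M :: "'a measure"
    and X :: "'a \<Rightarrow> nat ^ 'k"
    and S :: "(nat ^ 'k) set"
    and w g :: "real ^ 'k \<Rightarrow> real"
    and n :: nat and \<pi> :: "real ^ 'k"
    and r :: real and \<theta> :: "real ^ 'k"
  assumes "prob_space M"
    and "(n \<ge> 1 \<and> valid_probs \<pi> \<and> has_pmf M X (multinomial_pmf n \<pi>)
            \<and> w = multinomial_weight n \<pi> \<and> S = multinomial_support n)
         \<or> (r > 0 \<and> valid_probs \<theta> \<and> has_pmf M X (neg_multinomial_pmf r \<theta>)
            \<and> w = neg_multinomial_weight r \<theta> \<and> S = neg_multinomial_support)"
    and "finite_variance M (\<lambda>\<omega>. g (real_vec (X \<omega>)))"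
  shows "ennreal (variance_of M (\<lambda>\<omega>. g (real_vec (X \<omega>))))
           \<le> weighted_gradient_bound M (\<lambda>\<omega>. real_vec (X \<omega>)) w g
       \<and> (ennreal (variance_of M (\<lambda>\<omega>. g (real_vec (X \<omega>))))
            = weighted_gradient_bound M (\<lambda>\<omega>. real_vec (X \<omega>)) w g
          \<longleftrightarrow> linear_on_support g S)"
  using assms(2)
proof (elim disjE conjE)
  assume "n \<ge> 1" "valid_probs \<pi>" "has_pmf M X (multinomial_pmf n \<pi>)"
    and eqs: "w = multinomial_weight n \<pi>" "S = multinomial_support n"
  from multinomial_variance_bound[OF assms(1) this(1-3), of g] show ?thesis
    unfolding eqs by (rule conjI)
next
  assume "r > 0" "valid_probs \<theta>" "has_pmf M X (neg_multinomial_pmf r \<theta>)"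
    and eqs: "w = neg_multinomial_weight r \<theta>" "S = neg_multinomial_support"
  from neg_multinomial_variance_bound[OF assms(1) this(1-3) assms(3)] show ?thesis
    unfolding eqs by (rule conjI)
qed

end
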